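(* Let $(M,\omega)$ be a compact connected symplectic manifold and let $f,g\in C^\infty(M)$. Let $\widetilde f,\widetilde g$ be the functions on the path space $\mathcal{P}M$ given by $\widetilde f(\gamma)=\int_0^1 f(\gamma(t))\,dt$ and $\widetilde g(\gamma)=\int_0^1 g(\gamma(t))\,dt$. Then for all $\gamma\in\mathcal{P}M$, $$\{\widetilde f,\widetilde g\}_{\mathcal{P}M}(\gamma)=\int_0^1\{f,g\}(\gamma(t))\,dt.$$
   Context: $\mathcal{P}M$ is the space of all smooth maps $\gamma:[0,1]\to M$, with its standard (Chen) differentiable structure; the tangent space at $\gamma$ is the space of smooth vector fields along $\gamma$. With $\mathrm{ev}_t(\gamma)=\gamma(t)$, one has $d\,\mathrm{ev}_t(v(\gamma))=(v(\gamma))(t)$. The weakly symplectic form on $\mathcal{P}M$ is $$\bigl(\widetilde\omega(v_1,v_2)\bigr)(\gamma)=\int_0^1\omega\bigl(d\,\mathrm{ev}_t(v_1(\gamma)),d\,\mathrm{ev}_t(v_2(\gamma))\bigr)\,dt.$$ On $M$: the Hamiltonian vector field $X_f$ is defined by $i_{X_f}\omega=-df$ and $\{f,g\}=\omega(X_f,X_g)$. On $\mathcal{P}M$: the Hamiltonian vector field $\widetilde X_\phi$ of a function $\phi$ is the (unique, if it exists) vector field with $i_{\widetilde X_\phi}\widetilde\omega=-\mathrm{d}\phi$, and $\{\phi_1,\phi_2\}_{\mathcal{P}M}=\widetilde\omega(\widetilde X_{\phi_1},\widetilde X_{\phi_2})$. The differential of $\widetilde f$ is $(\mathrm{d}\widetilde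 f(v))(\gamma)=\int_0^1 df(d\,\mathrm{ev}_t(v(\gamma)))\,dt$. *)

theory Defs
  imports "HOL-Analysis.Analysis"
begin

subsection \<open>Smooth functions on subsets of normed spaces\<close>

text \<open>
  Besides open sets, these notions are used for relatively open subsets of convex sets \<open>C\<close> with
  nonempty interior in some finite-dimensional subspace \<open>R\<close> (for instance \<open>{0..1}\<close>). There a
  derivative within the set is unique on \<open>R\<close>, and the definition is the usual one: all partial
  derivatives exist in the interior and extend continuously to the set. Directions outside \<open>R\<close>
  impose no condition, since \<open>f' x\<close> may be chosen to factor through a projection onto \<open>R\<close>.
\<close>

primrec Ck_on :: "nat \<Rightarrow> 'a::real_normed_vector set \<Rightarrow> ('a \<Rightarrow> 'b::real_normed_vector) \<Rightarrow> bool" where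
  "Ck_on 0 S f \<longleftrightarrow> continuous_on S f"
| "Ck_on (Suc k) S f \<longleftrightarrow>
     (\<exists>f'. (\<forall>x\<in>S. (f has_derivative f' x) (at x within S)) \<and> (\<forall>v. Ck_on k S (\<lambda>x. f' x v)))"

definition smooth_on :: "'a::real_normed_vector set \<Rightarrow> ('a \<Rightarrow> 'b::real_normed_vector) \<Rightarrow> bool" where
  "smooth_on S f \<longleftrightarrow> (\<forall>k. Ck_on k S f)"


subsection \<open>Smooth manifolds\<close>

text \<open>
  A manifold is a topology \<open>X\<close> with a (not necessarily maximal) smooth atlas \<open>A\<close>. A chart is a pair
  of its domain \<open>U\<close> and its coordinate map \<open>\<phi>\<close>; the values of \<open>\<phi>\<close> outside \<open>U\<close> are irrelevant.
  The model space \<open>'e\<close> is an inner product space required to be finite-dimensional; the class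
  \<open>euclidean_space\<close> is not used because it excludes dimension 0.
\<close>

type_synonym ('m, 'e) chart = "'m set \<times> ('m \<Rightarrow> 'e)"

abbreviation chart_inv :: "('m, 'e) chart \<Rightarrow> 'e \<Rightarrow> 'm" where
  "chart_inv c \<equiv> inv_into (fst c) (snd c)"

definition smooth_atlas :: "'m topology \<Rightarrow> ('m, 'e::real_inner) chart set \<Rightarrow> bool" where
  "smooth_atlas X A \<longleftrightarrow>
     (\<forall>(U, \<phi>)\<in>A. openin X U \<and> open (\<phi> ` U) \<and>
        homeomorphic_map (subtopology X U) (top_of_set (\<phi> ` U)) \<phi>) \<and>
     (\<Union>(U, \<phi>)\<in>A. U) = topspace X \<and>
     (\<forall>(U, \<phi>)\<in>A. \<forall>(V, \<psi>)\<in>A. smooth_on (\<phi> ` (U \<inter> V)) (\<psi> \<circ> inv_into U \<phi>))"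

definition second_countable_space :: "'m topology \<Rightarrow> bool" where
  "second_countable_space X \<longleftrightarrow>
     (\<exists>\<B>. countable \<B> \<and> (\<forall>V\<in>\<B>. openin X V) \<and>
        (\<forall>U x. openin X U \<and> x \<in> U \<longrightarrow> (\<exists>V\<in>\<B>. x \<in> V \<and> V \<subseteq> U)))"

definition smooth_manifold :: "'m topology \<Rightarrow> ('m, 'e::real_inner) chart set \<Rightarrow> bool" where
  "smooth_manifold X A \<longleftrightarrow>
     (\<exists>B::'e set. finite B \<and> span B = UNIV) \<and>
     Hausdorff_space X \<and> second_countable_space X \<and> smooth_atlas X A"

definition smooth_fun :: "('m, 'e::real_inner) chart set \<Rightarrow> ('m \<Rightarrow> real) \<Rightarrow> bool" where
  "smooth_fun A f \<longleftrightarrow> (\<forall>c\<in>A. smooth_on (snd c ` fst c) (f \<circ> chart_inv c))"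

definition smooth_into ::
  "'m topology \<Rightarrow> ('m, 'e::real_inner) chart set \<Rightarrow> 'p::real_normed_vector set \<Rightarrow> ('p \<Rightarrow> 'm) \<Rightarrow> bool"
where
  "smooth_into X A S F \<longleftrightarrow>
     continuous_map (top_of_set S) X F \<and>
     (\<forall>(U, \<phi>)\<in>A. smooth_on {x\<in>S. F x \<in> U} (\<phi> \<circ> F))"


subsection \<open>Tangent vectors and vector fields\<close>

text \<open>
  A tangent vector at \<open>p\<close> is the family of its coordinates in all charts around \<open>p\<close>, subject to the
  transformation rule; the entries at all other charts are 0, so that the vector space operations
  are pointwise and a vector is determined by its entries. The base point is not recorded in the
  family.
\<close>

type_synonym ('m, 'e) tangent = "('m, 'e) chart \<Rightarrow> 'e"

definition transition_deriv ::
  "('m, 'e::real_inner) chart \<Rightarrow> ('m, 'e) chart \<Rightarrow> 'm \<Rightarrow> 'e \<Rightarrow> 'e" where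
  "transition_deriv c d p = frechet_derivative (snd d \<circ> chart_inv c) (at (snd c p))"

definition tangent_space :: "('m, 'e::real_inner) chart set \<Rightarrow> 'm \<Rightarrow> ('m, 'e) tangent set" where
  "tangent_space A p =
     {v. (\<forall>c\<in>A. \<forall>d\<in>A. p \<in> fst c \<and> p \<in> fst d \<longrightarrow> v d = transition_deriv c d p (v c)) \<and>
         (\<forall>c. \<not> (c \<in> A \<and> p \<in> fst c) \<longrightarrow> v c = 0)}"

text \<open>The tangent vector at \<open>p\<close> with coordinates \<open>a\<close> in the chart \<open>c\<close>.\<close>

definition tangent_of_coord ::
  "('m, 'e::real_inner) chart set \<Rightarrow> ('m, 'e) chart \<Rightarrow> 'm \<Rightarrow> 'e \<Rightarrow> ('m, 'e) tangent" where
  "tangent_of_coord A c p a =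
     (\<lambda>d. if d \<in> A \<and> p \<in> fst d then transition_deriv c d p a else 0)"

text \<open>The value \<open>df\<^sub>p(v)\<close>; it does not depend on the chart selected.\<close>

definition differential ::
  "('m, 'e::real_inner) chart set \<Rightarrow> ('m \<Rightarrow> real) \<Rightarrow> 'm \<Rightarrow> ('m, 'e) tangent \<Rightarrow> real" where
  "differential A f p v =
     (let c = (SOME c. c \<in> A \<and> p \<in> fst c)
      in frechet_derivative (f \<circ> chart_inv c) (at (snd c p)) (v c))"

definition vector_field ::
  "'m topology \<Rightarrow> ('m, 'e::real_inner) chart set \<Rightarrow> ('m \<Rightarrow> ('m, 'e) tangent) \<Rightarrow> bool" where
  "vector_field X A Y \<longleftrightarrow>
     Y \<in> extensional (topspace X) \<and>
     (\<forall>p\<in>topspace X. Y p \<in> tangent_space A p) \<and>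
     (\<forall>c\<in>A. smooth_on (snd c ` fst c) (\<lambda>x. Y (chart_inv c x) c))"

definition smooth_along ::
  "('m, 'e::real_inner) chart set \<Rightarrow> 'p::real_normed_vector set \<Rightarrow> ('p \<Rightarrow> 'm) \<Rightarrow>
     ('p \<Rightarrow> ('m, 'e) tangent) \<Rightarrow> bool" where
  "smooth_along A S F V \<longleftrightarrow>
     (\<forall>x\<in>S. V x \<in> tangent_space A (F x)) \<and>
     (\<forall>c\<in>A. smooth_on {x\<in>S. F x \<in> fst c} (\<lambda>x. V x c))"


subsection \<open>Symplectic forms, Hamiltonian vector fields and Poisson brackets\<close>

type_synonym ('m, 'e) form2 = "'m \<Rightarrow> ('m, 'e) tangent \<Rightarrow> ('m, 'e) tangent \<Rightarrow> real"

definition form_in_chart ::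
  "('m, 'e::real_inner) chart set \<Rightarrow> ('m, 'e) form2 \<Rightarrow> ('m, 'e) chart \<Rightarrow> 'e \<Rightarrow> 'e \<Rightarrow> 'e \<Rightarrow> real" where
  "form_in_chart A \<omega> c x a b =
     (let p = chart_inv c x in \<omega> p (tangent_of_coord A c p a) (tangent_of_coord A c p b))"

definition smooth_2form ::
  "'m topology \<Rightarrow> ('m, 'e::real_inner) chart set \<Rightarrow> ('m, 'e) form2 \<Rightarrow> bool" where
  "smooth_2form X A \<omega> \<longleftrightarrow>
     (\<forall>p\<in>topspace X.
        (\<forall>u\<in>tangent_space A p. \<forall>v\<in>tangent_space A p. \<forall>w\<in>tangent_space A p. \<forall>r s.
           \<omega> p (\<lambda>c. r *\<^sub>R u c + s *\<^sub>R v c) w = r * \<omega> p u w + s * \<omega> p v w) \<and>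
        (\<forall>u\<in>tangent_space A p. \<forall>v\<in>tangent_space A p. \<omega> p u v = - \<omega> p v u)) \<and>
     (\<forall>c\<in>A. \<forall>a b. smooth_on (snd c ` fst c) (\<lambda>x. form_in_chart A \<omega> c x a b))"

text \<open>The equation below is \<open>d\<omega>(a, b, e) = 0\<close> for constant coordinate vector fields \<open>a\<close>, \<open>b\<close>, \<open>e\<close>.\<close>

definition closed_2form ::
  "('m, 'e::real_inner) chart set \<Rightarrow> ('m, 'e) form2 \<Rightarrow> bool" where
  "closed_2form A \<omega> \<longleftrightarrow>
     (\<forall>c\<in>A. \<forall>x\<in>snd c ` fst c. \<forall>a b e.
        frechet_derivative (\<lambda>y. form_in_chart A \<omega> c y b e) (at x) a +
        frechet_derivative (\<lambda>y. form_in_chart A \<omega> c y e a) (at x) b +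
        frechet_derivative (\<lambda>y. form_in_chart A \<omega> c y a b) (at x) e = 0)"

definition nondegenerate_2form ::
  "'m topology \<Rightarrow> ('m, 'e::real_inner) chart set \<Rightarrow> ('m, 'e) form2 \<Rightarrow> bool" where
  "nondegenerate_2form X A \<omega> \<longleftrightarrow>
     (\<forall>p\<in>topspace X. \<forall>v\<in>tangent_space A p.
        (\<forall>w\<in>tangent_space A p. \<omega> p v w = 0) \<longrightarrow> v = (\<lambda>_. 0))"

definition symplectic_form ::
  "'m topology \<Rightarrow> ('m, 'e::real_inner) chart set \<Rightarrow> ('m, 'e) form2 \<Rightarrow> bool" where
  "symplectic_form X A \<omega> \<longleftrightarrow>
     smooth_2form X A \<omega> \<and> closed_2form A \<omega> \<and> nondegenerate_2form X A \<omega>"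

definition hamiltonian_vf ::
  "'m topology \<Rightarrow> ('m, 'e::real_inner) chart set \<Rightarrow> ('m, 'e) form2 \<Rightarrow> ('m \<Rightarrow> real) \<Rightarrow>
     'm \<Rightarrow> ('m, 'e) tangent" where
  "hamiltonian_vf X A \<omega> f =
     (THE Y. vector_field X A Y \<and>
        (\<forall>p\<in>topspace X. \<forall>v\<in>tangent_space A p. \<omega> p (Y p) v = - differential A f p v))"

definition poisson ::
  "'m topology \<Rightarrow> ('m, 'e::real_inner) chart set \<Rightarrow> ('m, 'e) form2 \<Rightarrow> ('m \<Rightarrow> real) \<Rightarrow> ('m \<Rightarrow> real) \<Rightarrow>
     'm \<Rightarrow> real" where
  "poisson X A \<omega> f g p = \<omega> p (hamiltonian_vf X A \<omega> f p) (hamiltonian_vf X A \<omega> g p)"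


subsection \<open>The path space\<close>

text \<open>
  Maps on \<open>{0..1}\<close> and on the path space are taken extensional, so that equality of HOL functions is
  equality of maps.
\<close>

definition path_space :: "'m topology \<Rightarrow> ('m, 'e::real_inner) chart set \<Rightarrow> (real \<Rightarrow> 'm) set" where
  "path_space X A = {\<gamma> \<in> extensional {0..1}. smooth_into X A {0..1} \<gamma>}"

definition path_tangent ::
  "('m, 'e::real_inner) chart set \<Rightarrow> (real \<Rightarrow> 'm) \<Rightarrow> (real \<Rightarrow> ('m, 'e) tangent) set" where
  "path_tangent A \<gamma> = {v \<in> extensional {0..1}. smooth_along A {0..1} \<gamma> v}"

text \<open>The Chen structure: a map into the path space is smooth iff its adjoint is.\<close>

definition path_plot ::
  "'m topology \<Rightarrow> ('m, 'e::real_inner) chart set \<Rightarrow> 'p::real_normed_vector set \<Rightarrow>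
     ('p \<Rightarrow> real \<Rightarrow> 'm) \<Rightarrow> bool" where
  "path_plot X A C \<Gamma> \<longleftrightarrow>
     (\<forall>u\<in>C. \<Gamma> u \<in> path_space X A) \<and> smooth_into X A (C \<times> {0..1}) (\<lambda>(u, t). \<Gamma> u t)"

text \<open>
  Domains of Chen plots are the convex subsets with nonempty interior of \<open>R\<^sup>n\<close>, \<open>n\<close> arbitrary. To
  quantify over \<open>n\<close>, all \<open>R\<^sup>n\<close> are realised in one normed space, as the bounded sequences
  (functions on the discrete space \<open>nat\<close>) vanishing from \<open>n\<close> on.
\<close>

definition Rn :: "nat \<Rightarrow> (nat \<Rightarrow>\<^sub>C real) set" where
  "Rn n = {x. \<forall>i\<ge>n. apply_bcontfun x i = 0}"

definition chen_domain :: "(nat \<Rightarrow>\<^sub>C real) set \<Rightarrow> bool" where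
  "chen_domain C \<longleftrightarrow>
     (\<exists>n. convex C \<and> C \<subseteq> Rn n \<and> (\<exists>W. W \<noteq> {} \<and> W \<subseteq> C \<and> openin (top_of_set (Rn n)) W))"

definition path_vector_field ::
  "'m topology \<Rightarrow> ('m, 'e::real_inner) chart set \<Rightarrow>
     ((real \<Rightarrow> 'm) \<Rightarrow> real \<Rightarrow> ('m, 'e) tangent) \<Rightarrow> bool" where
  "path_vector_field X A \<Xi> \<longleftrightarrow>
     \<Xi> \<in> extensional (path_space X A) \<and>
     (\<forall>\<gamma>\<in>path_space X A. \<Xi> \<gamma> \<in> path_tangent A \<gamma>) \<and>
     (\<forall>C \<Gamma>. chen_domain C \<and> path_plot X A C \<Gamma> \<longrightarrow>
        smooth_along A (C \<times> {0..1}) (\<lambda>(u, t). \<Gamma> u t) (\<lambda>(u, t). \<Xi> (\<Gamma> u) t))"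

text \<open>The tangent vector at \<open>\<Gamma> 0\<close> of a smooth curve \<open>\<Gamma>\<close> in the path space.\<close>

definition path_velocity ::
  "('m, 'e::real_inner) chart set \<Rightarrow> (real \<Rightarrow> real \<Rightarrow> 'm) \<Rightarrow> real \<Rightarrow> ('m, 'e) tangent" where
  "path_velocity A \<Gamma> =
     (\<lambda>t\<in>{0..1}. \<lambda>c. if c \<in> A \<and> \<Gamma> 0 t \<in> fst c
        then vector_derivative (\<lambda>s. snd c (\<Gamma> s t)) (at 0) else 0)"

text \<open>
  \<open>L\<close> is the differential at \<open>\<gamma>\<close> of \<open>\<Phi>\<close>: its value at the velocity of any smooth curve through \<open>\<gamma>\<close>
  is the derivative of \<open>\<Phi>\<close> along that curve. Every vector tangent to the path space at \<open>\<gamma>\<close> is such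
  a velocity, so \<open>L\<close> is determined on the tangent space.
\<close>

definition has_path_differential ::
  "'m topology \<Rightarrow> ('m, 'e::real_inner) chart set \<Rightarrow> ((real \<Rightarrow> 'm) \<Rightarrow> real) \<Rightarrow> (real \<Rightarrow> 'm) \<Rightarrow>
     ((real \<Rightarrow> ('m, 'e) tangent) \<Rightarrow> real) \<Rightarrow> bool" where
  "has_path_differential X A \<Phi> \<gamma> L \<longleftrightarrow>
     (\<forall>\<epsilon>>0. \<forall>\<Gamma>. path_plot X A {-\<epsilon><..<\<epsilon>} \<Gamma> \<and> \<Gamma> 0 = \<gamma> \<longrightarrow>
        ((\<lambda>s. \<Phi> (\<Gamma> s)) has_real_derivative L (path_velocity A \<Gamma>)) (at 0))"

text \<open>The differential of the evaluation at time \<open>t\<close> maps \<open>v\<close> to \<open>v t\<close>.\<close>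

definition path_form ::
  "('m, 'e::real_inner) form2 \<Rightarrow> (real \<Rightarrow> 'm) \<Rightarrow> (real \<Rightarrow> ('m, 'e) tangent) \<Rightarrow>
     (real \<Rightarrow> ('m, 'e) tangent) \<Rightarrow> real" where
  "path_form \<omega> \<gamma> v w = integral {0..1} (\<lambda>t. \<omega> (\<gamma> t) (v t) (w t))"

definition path_hamiltonian_vf ::
  "'m topology \<Rightarrow> ('m, 'e::real_inner) chart set \<Rightarrow> ('m, 'e) form2 \<Rightarrow> ((real \<Rightarrow> 'm) \<Rightarrow> real) \<Rightarrow>
     (real \<Rightarrow> 'm) \<Rightarrow> real \<Rightarrow> ('m, 'e) tangent" where
  "path_hamiltonian_vf X A \<omega> \<Phi> =
     (THE \<Xi>. path_vector_field X A \<Xi> \<and>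
        (\<forall>\<gamma>\<in>path_space X A.
           has_path_differential X A \<Phi> \<gamma> (\<lambda>v. - path_form \<omega> \<gamma> (\<Xi> \<gamma>) v)))"

definition path_poisson ::
  "'m topology \<Rightarrow> ('m, 'e::real_inner) chart set \<Rightarrow> ('m, 'e) form2 \<Rightarrow> ((real \<Rightarrow> 'm) \<Rightarrow> real) \<Rightarrow>
     ((real \<Rightarrow> 'm) \<Rightarrow> real) \<Rightarrow> (real \<Rightarrow> 'm) \<Rightarrow> real" where
  "path_poisson X A \<omega> \<Phi> \<Psi> \<gamma> =
     path_form \<omega> \<gamma> (path_hamiltonian_vf X A \<omega> \<Phi> \<gamma>) (path_hamiltonian_vf X A \<omega> \<Psi> \<gamma>)"

definition path_average :: "('m \<Rightarrow> real) \<Rightarrow> (real \<Rightarrow> 'm) \<Rightarrow> real" where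
  "path_average f \<gamma> = integral {0..1} (\<lambda>t. f (\<gamma> t))"

end

theory Submission
  imports Defs "HOL-Real_Asymp.Real_Asymp"
begin

text \<open>
  The form on the path space is obtained by integrating \<open>\<omega>\<close> along a path, so it pairs tangent
  vectors time by time. Differentiation under the integral sign gives
  \<open>d(path_average f)(v) = \<integral> df(v t) dt = - \<integral> \<omega> (X\<^sub>f (\<gamma> t)) (v t) dt\<close>, which says that the field
  \<open>\<gamma> \<mapsto> X\<^sub>f \<circ> \<gamma>\<close>, called the lift of \<open>X\<^sub>f\<close> below, is a Hamiltonian field of the averaged function.
  Inserting the lifts of \<open>X\<^sub>f\<close> and \<open>X\<^sub>g\<close> into the form gives the average of \<open>\<omega> (X\<^sub>f, X\<^sub>g)\<close>.

  Hamiltonian fields are definite descriptions, on the manifold and on the path space. The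
  argument above therefore rests on existence and uniqueness in both places.

  On the manifold, nondegeneracy makes the equation of \<open>X\<^sub>f\<close> uniquely solvable at each point. In a
  chart it is a linear system with smooth coefficients, and \<open>Ck_on_linear_solution\<close> shows that such
  solutions are smooth.

  On the path space, the lift is smooth because composing a plot with a smooth field is smooth
  (\<open>path_vector_field_lift\<close>), and it satisfies the Hamiltonian equation by
  \<open>path_average_derivative\<close>. For uniqueness, suppose that two Hamiltonian fields differ at a path
  \<open>\<gamma>\<close> and a time \<open>t\<^sub>0\<close>, with difference \<open>D\<close>. Choose a coordinate vector \<open>a\<close> at \<open>\<gamma> t\<^sub>0\<close> with
  \<open>\<omega> (D t\<^sub>0) a > 0\<close> and move \<open>\<gamma>\<close> in the direction \<open>a\<close>, damped by a bump function supported near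
  \<open>t\<^sub>0\<close>. The variation moves only inside a single chart, where it is given by vector addition
  (\<open>path_variation_exists\<close>). Pairing its velocity with \<open>D\<close> gives the integral of a
  continuous nonnegative function that is positive at \<open>t\<^sub>0\<close>, whereas equality of the two
  differentials forces this integral to vanish (\<open>path_tangent_separation\<close>).
\<close>

section \<open>Finite frames\<close>

text \<open>
  Orthonormal bases have this expansion property, and it is meaningful in every finite-dimensional
  inner product space, dimension 0 included.
\<close>

definition finite_frame :: "'e::real_inner set \<Rightarrow> bool" where
  "finite_frame E \<longleftrightarrow> finite E \<and> (\<forall>v. (\<Sum>b\<in>E. (v \<bullet> b) *\<^sub>R b) = v)"

lemma finite_frame_finite: "finite_frame E \<Longrightarrow> finite E"
  by (simp add: finite_frame_def)

lemma finite_frame_expand: "finite_frame E \<Longrightarrow> (\<Sum>b\<in>E. (v \<bullet> b) *\<^sub>R b) = v"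
  by (simp add: finite_frame_def)

lemma finite_frame_Basis: "finite_frame (Basis :: 'a::euclidean_space set)"
  by (simp add: finite_frame_def euclidean_representation)

text \<open>
  Gram-Schmidt turns a finite spanning set into a pairwise orthogonal one. Dropping the zero vector
  and normalising makes the expansion formula hold, by induction over the span.
\<close>

lemma finite_frame_exists:
  fixes B :: "'e::real_inner set"
  assumes "finite B" and "span B = UNIV"
  obtains E :: "'e set" where "finite_frame E"
proof -
  obtain C where C: "finite C" "span C = span B" "pairwise orthogonal C"
    using basis_orthogonal[OF assms(1)] by blast
  define D where "D = C - {0}"
  have D: "finite D" "span D = UNIV" "pairwise orthogonal D" "0 \<notin> D"
    using C assms(2) by (auto simp: D_def pairwise_def span_delete_0)
  define E where "E = (\<lambda>b. b /\<^sub>R norm b) ` D"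
  have inj: "inj_on (\<lambda>b. b /\<^sub>R norm b) D"
  proof (rule inj_onI, rule ccontr)
    fix a b assume ab: "a \<in> D" "b \<in> D" "a /\<^sub>R norm a = b /\<^sub>R norm b" "a \<noteq> b"
    then have "a \<bullet> b = 0" using D(3) by (auto simp: pairwise_def orthogonal_def)
    then have "(a /\<^sub>R norm a) \<bullet> (b /\<^sub>R norm b) = 0" by simp
    then have "(a /\<^sub>R norm a) \<bullet> (a /\<^sub>R norm a) = 0" using ab by simp
    with ab D(4) show False by auto
  qed
  have eq: "(\<Sum>b\<in>E. (v \<bullet> b) *\<^sub>R b) = (\<Sum>b\<in>D. ((v \<bullet> b) / (b \<bullet> b)) *\<^sub>R b)" for v
    unfolding E_def by (subst sum.reindex[OF inj])
      (auto intro!: sum.cong simp: dot_square_norm power2_eq_square divide_simps)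
  have "(\<Sum>b\<in>D. ((v \<bullet> b) / (b \<bullet> b)) *\<^sub>R b) = v" for v
  proof -
    have "v \<in> span D" using D by simp
    then show ?thesis
    proof (induction rule: span_induct_alt)
      case base
      show ?case by simp
    next
      case (step r d y)
      have "(\<Sum>b\<in>D. ((d \<bullet> b) / (b \<bullet> b)) *\<^sub>R b) = (\<Sum>b\<in>D. if b = d then d else 0)"
      proof (rule sum.cong[OF refl])
        fix b assume "b \<in> D"
        then show "((d \<bullet> b) / (b \<bullet> b)) *\<^sub>R b = (if b = d then d else 0)"
          using D(3,4) step(1) by (auto simp: pairwise_def orthogonal_def)
      qed
      also have "\<dots> = d" using D(1) step(1) by simp
      finally have d: "(\<Sum>b\<in>D. ((d \<bullet> b) / (b \<bullet> b)) *\<^sub>R b) = d" .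
      have "(\<Sum>b\<in>D. (((r *\<^sub>R d + y) \<bullet> b) / (b \<bullet> b)) *\<^sub>R b) =
         r *\<^sub>R (\<Sum>b\<in>D. ((d \<bullet> b) / (b \<bullet> b)) *\<^sub>R b) + (\<Sum>b\<in>D. ((y \<bullet> b) / (b \<bullet> b)) *\<^sub>R b)"
        by (simp add: inner_add_left add_divide_distrib scaleR_add_left sum.distrib scaleR_sum_right)
      with d step(2) show ?case by simp
    qed
  qed
  with eq D(1) have "finite_frame E" by (auto simp: finite_frame_def E_def)
  then show ?thesis by (rule that)
qed

lemma linear_frame_expand:
  fixes E :: "'e::real_inner set" and f :: "'e \<Rightarrow> 'b::real_normed_vector"
  assumes "finite_frame E" and "linear f"
  shows "f v = (\<Sum>b\<in>E. (v \<bullet> b) *\<^sub>R f b)"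
proof -
  have "f v = f (\<Sum>b\<in>E. (v \<bullet> b) *\<^sub>R b)" using finite_frame_expand[OF assms(1)] by simp
  then show ?thesis by (simp add: linear_sum[OF assms(2)] linear_scale[OF assms(2)])
qed

lemma linear_bounded_linear_frame:
  fixes E :: "'e::real_inner set" and f :: "'e \<Rightarrow> 'b::real_normed_vector"
  assumes "finite_frame E" and "linear f"
  shows "bounded_linear f"
proof -
  have "bounded_linear (\<lambda>v. \<Sum>b\<in>E. (v \<bullet> b) *\<^sub>R f b)"
    by (intro bounded_linear_sum bounded_linear_compose[OF bounded_linear_scaleR_left bounded_linear_inner_left])
  moreover have "(\<lambda>v. \<Sum>b\<in>E. (v \<bullet> b) *\<^sub>R f b) = f"
    by (rule ext) (rule linear_frame_expand[OF assms, symmetric])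
  ultimately show ?thesis by simp
qed

text \<open>
  A maximal independent subset of the frame is a finite basis, so the dimension count for
  endomorphisms applies.
\<close>

lemma linear_injective_imp_bij_frame:
  fixes E :: "'e::real_inner set" and f :: "'e \<Rightarrow> 'e"
  assumes E: "finite_frame E" and f: "linear f" and inj: "inj f"
  shows "bij f"
proof -
  have "v \<in> span E" for v
  proof -
    have "(\<Sum>b\<in>E. (v \<bullet> b) *\<^sub>R b) \<in> span E" by (intro span_sum span_scale span_base)
    then show ?thesis using finite_frame_expand[OF E] by simp
  qed
  then have sp: "span E = UNIV" by auto
  obtain B :: "'e set" where B: "B \<subseteq> E" "independent B" "E \<subseteq> span B"
    using maximal_independent_subset by blast
  then have spB: "span B = UNIV" using sp by (metis span_mono span_span top.extremum_uniqueI)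
  have finB: "finite B" using B(1) finite_frame_finite[OF E] by (rule finite_subset)
  interpret finite_dimensional_vector_space "scaleR :: real \<Rightarrow> 'e \<Rightarrow> 'e" B
    by unfold_locales (use B(2) finB spB in \<open>simp_all only: dependent_raw_def span_raw_def not_False_eq_True\<close>)
  have "surj f"
    by (rule linear_inj_imp_surj[OF f[unfolded linear_def] inj])
  then show ?thesis using inj by (simp add: bij_def)
qed

section \<open>Calculus of \<open>C\<^sup>k\<close> maps\<close>

lemma Ck_on_imp_continuous_on: "Ck_on k S f \<Longrightarrow> continuous_on S f"
  by (cases k) (auto simp: continuous_on_eq_continuous_within intro: has_derivative_continuous)

lemma Ck_on_Suc_D: "Ck_on (Suc k) S f \<Longrightarrow> Ck_on k S f"
proof (induction k arbitrary: f)
  case 0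
  then show ?case using Ck_on_imp_continuous_on by fastforce
next
  case (Suc k)
  then show ?case by (metis Ck_on.simps(2))
qed

lemma Ck_on_subset: "Ck_on k S f \<Longrightarrow> T \<subseteq> S \<Longrightarrow> Ck_on k T f"
proof (induction k arbitrary: f)
  case 0
  then show ?case by (auto intro: continuous_on_subset)
next
  case (Suc k)
  then obtain f' where f': "\<And>x. x \<in> S \<Longrightarrow> (f has_derivative f' x) (at x within S)"
    "\<And>v. Ck_on k S (\<lambda>x. f' x v)" by auto
  show ?case unfolding Ck_on.simps
    by (intro exI[of _ f'])
       (use f' Suc has_derivative_subset in blast)
qed

lemma Ck_on_cong_imp:
  assumes "Ck_on k S f" and "\<And>x. x \<in> S \<Longrightarrow> f x = g x"
  shows "Ck_on k S g"
proof (cases k)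
  case 0
  then show ?thesis using assms continuous_on_cong by (metis Ck_on.simps(1))
next
  case (Suc j)
  with assms obtain f' where f': "\<And>x. x \<in> S \<Longrightarrow> (f has_derivative f' x) (at x within S)"
    "\<And>v. Ck_on j S (\<lambda>x. f' x v)" by auto
  have "(g has_derivative f' x) (at x within S)" if "x \<in> S" for x
    using has_derivative_transform[OF that _ f'(1)[OF that]] assms(2) by simp
  with f'(2) Suc show ?thesis by auto
qed

lemma Ck_on_cong:
  assumes "\<And>x. x \<in> S \<Longrightarrow> f x = g x"
  shows "Ck_on k S f \<longleftrightarrow> Ck_on k S g"
  using Ck_on_cong_imp[of k S f g] Ck_on_cong_imp[of k S g f] assms by auto

lemma Ck_on_const: "Ck_on k S (\<lambda>x. c)"
proof (induction k arbitrary: c)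
  case (Suc k)
  show ?case unfolding Ck_on.simps
    by (rule exI[of _ "\<lambda>_ _. 0"]) (use Suc in auto)
qed simp

lemma Ck_on_bounded_linear:
  assumes "bounded_linear L"
  shows "Ck_on k S L"
proof (cases k)
  case 0
  then show ?thesis using assms by (simp add: linear_continuous_on)
next
  case (Suc k)
  then show ?thesis unfolding Suc Ck_on.simps
    by (intro exI[of _ "\<lambda>_. L"])
       (use assms in \<open>auto intro: Ck_on_const bounded_linear_imp_has_derivative\<close>)
qed

lemma Ck_on_bounded_linear_compose:
  assumes "bounded_linear L" and "Ck_on k S f"
  shows "Ck_on k S (\<lambda>x. L (f x))"
  using assms(2)
proof (induction k arbitrary: f)
  case 0
  then show ?case using assms(1) bounded_linear.continuous_on by auto
next
  case (Suc k)
  then obtain f' where f': "\<And>x. x \<in> S \<Longrightarrow> (f has_derivative f' x) (at x within S)"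
    "\<And>v. Ck_on k S (\<lambda>x. f' x v)" by auto
  show ?case unfolding Ck_on.simps
    by (intro exI[of _ "\<lambda>x v. L (f' x v)"])
       (auto intro: Suc.IH f' bounded_linear.has_derivative[OF assms(1)])
qed

lemma Ck_on_add:
  assumes "Ck_on k S f" and "Ck_on k S g"
  shows "Ck_on k S (\<lambda>x. f x + g x)"
  using assms
proof (induction k arbitrary: f g)
  case 0
  then show ?case by (auto intro: continuous_on_add)
next
  case (Suc k)
  from Suc.prems obtain f' g' where
    "\<And>x. x \<in> S \<Longrightarrow> (f has_derivative f' x) (at x within S)" "\<And>v. Ck_on k S (\<lambda>x. f' x v)"
    "\<And>x. x \<in> S \<Longrightarrow> (g has_derivative g' x) (at x within S)" "\<And>v. Ck_on k S (\<lambda>x. g' x v)"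
    unfolding Ck_on.simps by metis
  then show ?case unfolding Ck_on.simps
    by (intro exI[of _ "\<lambda>x v. f' x v + g' x v"]) (auto intro: Suc.IH has_derivative_add)
qed

lemma Ck_on_sum:
  assumes "\<And>i. i \<in> I \<Longrightarrow> Ck_on k S (f i)"
  shows "Ck_on k S (\<lambda>x. \<Sum>i\<in>I. f i x)"
  using assms by (induction I rule: infinite_finite_induct) (auto intro: Ck_on_const Ck_on_add)

lemma Ck_on_bilinear:
  fixes prod :: "'b::real_normed_vector \<Rightarrow> 'c::real_normed_vector \<Rightarrow> 'd::real_normed_vector"
  assumes "bounded_bilinear prod" and "Ck_on k S f" and "Ck_on k S g"
  shows "Ck_on k S (\<lambda>x. prod (f x) (g x))"
  using assms(2,3)
proof (induction k arbitrary: f g)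
  case 0
  then show ?case using bounded_bilinear.continuous_on[OF assms(1)] by auto
next
  case (Suc k)
  from Suc.prems obtain f' g' where f':
    "\<And>x. x \<in> S \<Longrightarrow> (f has_derivative f' x) (at x within S)" "\<And>v. Ck_on k S (\<lambda>x. f' x v)"
    and g':
    "\<And>x. x \<in> S \<Longrightarrow> (g has_derivative g' x) (at x within S)" "\<And>v. Ck_on k S (\<lambda>x. g' x v)"
    unfolding Ck_on.simps by metis
  have *: "Ck_on k S f" "Ck_on k S g" using Suc.prems by (blast intro: Ck_on_Suc_D)+
  show ?case unfolding Ck_on.simps
    by (intro exI[of _ "\<lambda>x v. prod (f x) (g' x v) + prod (f' x v) (g x)"])
       (auto intro!: Suc.IH Ck_on_add bounded_bilinear.FDERIV[OF assms(1)] f' g' *)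
qed

lemmas Ck_on_scaleR = Ck_on_bilinear[OF bounded_bilinear_scaleR]

text \<open>
  The chain rule gives the derivative \<open>g' (f x) (f' x v)\<close>, in which the direction \<open>f' x v\<close> moves with
  \<open>x\<close>, whereas \<open>Ck_on\<close> controls \<open>g'\<close> in constant directions only. Expanding \<open>f' x v\<close> in a frame of the
  middle space reduces to constant directions. Any choice of derivatives within \<open>S\<close> and \<open>T\<close> can be
  combined in this way, which makes the rule applicable to plots on arbitrary domains.
\<close>

lemma Ck_on_compose:
  fixes E :: "'e::real_inner set" and f :: "'a::real_normed_vector \<Rightarrow> 'e"
    and g :: "'e \<Rightarrow> 'b::real_normed_vector"
  assumes E: "finite_frame E"
    and "Ck_on k T g" and "Ck_on k S f" and ST: "f ` S \<subseteq> T"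
  shows "Ck_on k S (\<lambda>x. g (f x))"
  using assms(2,3)
proof (induction k arbitrary: g)
  case 0
  then show ?case using ST by (auto intro: continuous_on_compose2)
next
  case (Suc k)
  from Suc.prems obtain f' g' where f':
    "\<And>x. x \<in> S \<Longrightarrow> (f has_derivative f' x) (at x within S)" "\<And>v. Ck_on k S (\<lambda>x. f' x v)"
    and g':
    "\<And>x. x \<in> T \<Longrightarrow> (g has_derivative g' x) (at x within T)" "\<And>v. Ck_on k T (\<lambda>x. g' x v)"
    unfolding Ck_on.simps by metis
  have fk: "Ck_on k S f" using Suc.prems by (blast intro: Ck_on_Suc_D)
  show ?case unfolding Ck_on.simps
  proof (intro exI[of _ "\<lambda>x v. g' (f x) (f' x v)"] conjI ballI allI)
    fix x assume x: "x \<in> S"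
    have "(g has_derivative g' (f x)) (at (f x) within f ` S)"
      using g'(1) x ST by (meson has_derivative_subset image_subset_iff)
    from has_derivative_in_compose[OF f'(1)[OF x] this]
    show "((\<lambda>x. g (f x)) has_derivative (\<lambda>v. g' (f x) (f' x v))) (at x within S)" .
  next
    fix v
    have "Ck_on k S (\<lambda>x. \<Sum>b\<in>E. (f' x v \<bullet> b) *\<^sub>R g' (f x) b)"
      by (intro Ck_on_sum Ck_on_scaleR Ck_on_bounded_linear_compose[OF bounded_linear_inner_left]
          f' Suc.IH g' fk)
    then show "Ck_on k S (\<lambda>x. g' (f x) (f' x v))"
    proof (rule Ck_on_cong_imp)
      fix x assume "x \<in> S"
      then have "linear (g' (f x))"
        using g'(1) ST has_derivative_linear by blast
      then show "(\<Sum>b\<in>E. (f' x v \<bullet> b) *\<^sub>R g' (f x) b) = g' (f x) (f' x v)"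
        using linear_frame_expand[OF E] by metis
    qed
  qed
qed

text \<open>
  In the product rule the derivative of the factor \<open>c\<close> is multiplied by \<open>u x = 0\<close>, hence continuity of \<open>c\<close>
  suffices. This breaks the circle in the differentiability proof for solutions of linear systems,
  where \<open>c\<close> is a coordinate of the solution itself.
\<close>

lemma has_derivative_vanishing_times_continuous:
  fixes u :: "'a::real_normed_vector \<Rightarrow> 'b::real_normed_vector" and c :: "'a \<Rightarrow> real"
  assumes u: "(u has_derivative u') (at x within S)" and "u x = 0"
    and c: "continuous (at x within S) c"
  shows "((\<lambda>y. c y *\<^sub>R u y) has_derivative (\<lambda>v. c x *\<^sub>R u' v)) (at x within S)"
proof -
  have bl: "bounded_linear u'" using u by (rule has_derivative_bounded_linear)
  have lim: "((\<lambda>y. norm (u y - u x - u' (y - x)) / norm (y - x)) \<longlongrightarrow> 0) (at x within S)"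
    using u by (simp add: has_derivative_iff_norm)
  obtain K where K: "K > 0" "\<And>v. norm (u' v) \<le> norm v * K" 
    using bounded_linear.pos_bounded[OF bl] by blast
  have c': "((\<lambda>y. c y - c x) \<longlongrightarrow> 0) (at x within S)"
    using c by (simp add: continuous_within LIM_zero)
  have "((\<lambda>y. \<bar>c y\<bar> * (norm (u y - u x - u' (y - x)) / norm (y - x)) + \<bar>c y - c x\<bar> * K) \<longlongrightarrow>
      \<bar>c x\<bar> * 0 + 0 * K) (at x within S)"
    using c lim tendsto_rabs_zero[OF c']
    by (intro tendsto_add tendsto_mult tendsto_rabs tendsto_const) (auto simp: continuous_within)
  then have B: "((\<lambda>y. \<bar>c y\<bar> * (norm (u y - u x - u' (y - x)) / norm (y - x)) + \<bar>c y - c x\<bar> * K) \<longlongrightarrow> 0)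
      (at x within S)" by simp
  have "((\<lambda>y. norm (c y *\<^sub>R u y - c x *\<^sub>R u x - c x *\<^sub>R u' (y - x)) / norm (y - x)) \<longlongrightarrow> 0) (at x within S)"
  proof (rule tendsto_sandwich[OF _ _ tendsto_const B])
    show "\<forall>\<^sub>F y in at x within S. norm (c y *\<^sub>R u y - c x *\<^sub>R u x - c x *\<^sub>R u' (y - x)) / norm (y - x)
       \<le> \<bar>c y\<bar> * (norm (u y - u x - u' (y - x)) / norm (y - x)) + \<bar>c y - c x\<bar> * K"
    proof (rule always_eventually, rule allI)
      fix y
      have "c y *\<^sub>R u y - c x *\<^sub>R u x - c x *\<^sub>R u' (y - x)
         = c y *\<^sub>R (u y - u x - u' (y - x)) + (c y - c x) *\<^sub>R u' (y - x)"
        using assms(2) by (simp add: algebra_simps)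
      also have "norm \<dots> \<le> \<bar>c y\<bar> * norm (u y - u x - u' (y - x)) + \<bar>c y - c x\<bar> * norm (u' (y - x))"
        by (metis norm_scaleR norm_triangle_ineq)
      also have "\<dots> \<le> \<bar>c y\<bar> * norm (u y - u x - u' (y - x)) + \<bar>c y - c x\<bar> * (norm (y - x) * K)"
        using K(2) by (simp add: mult_left_mono)
      finally have *: "norm (c y *\<^sub>R u y - c x *\<^sub>R u x - c x *\<^sub>R u' (y - x)) \<le> \<dots>" .
      show "norm (c y *\<^sub>R u y - c x *\<^sub>R u x - c x *\<^sub>R u' (y - x)) / norm (y - x)
       \<le> \<bar>c y\<bar> * (norm (u y - u x - u' (y - x)) / norm (y - x)) + \<bar>c y - c x\<bar> * K"
        using divide_right_mono[OF *, of "norm (y - x)"] K(1)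
        by (cases "y = x") (auto simp: add_divide_distrib)
    qed
  qed auto
  then show ?thesis
    using bounded_linear_scaleR_right bounded_linear_compose[OF bounded_linear_scaleR_right bl]
    by (auto simp: has_derivative_iff_norm)
qed

section \<open>Linear systems with smooth coefficients\<close>

lemma bij_linear_imp_linear_inv:
  fixes f :: "'a::real_vector \<Rightarrow> 'b::real_vector"
  assumes "linear f" and "bij f"
  shows "linear (inv f)"
  using assms
  by (intro linearI inv_f_eq)
    (simp_all add: bij_is_inj bij_is_surj surj_f_inv_f linear_add linear_scale)

text \<open>
  With \<open>R\<close> the inverse of \<open>T x0\<close>, the operator norm of \<open>1 - R T x\<close> is at most a quantity \<open>m x\<close>
  tending to 0. So \<open>Y x - R (r x) = (1 - R T x) (Y x)\<close> has norm at most \<open>m x * norm (Y x)\<close>, which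
  first bounds \<open>Y\<close> near \<open>x0\<close> and then shows that \<open>Y x\<close> has the same limit as \<open>R (r x)\<close>.
\<close>

lemma linear_solution_continuous_on:
  fixes E :: "'e::real_inner set" and T :: "'p::real_normed_vector \<Rightarrow> 'e \<Rightarrow> 'e"
  assumes E: "finite_frame E"
    and lin: "\<And>x. x \<in> S \<Longrightarrow> linear (T x)" and inj: "\<And>x. x \<in> S \<Longrightarrow> inj (T x)"
    and T: "\<And>a. continuous_on S (\<lambda>x. T x a)"
    and r: "continuous_on S r" and Y: "\<And>x. x \<in> S \<Longrightarrow> T x (Y x) = r x"
  shows "continuous_on S Y"
  unfolding continuous_on_def
proof
  fix x0 assume x0: "x0 \<in> S"
  define R where "R = inv (T x0)"
  have bij: "bij (T x0)" using linear_injective_imp_bij_frame[OF E lin inj] x0 by blast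
  have RT: "R (T x0 a) = a" for a using bij by (simp add: R_def bij_is_inj)
  have linR: "linear R" unfolding R_def
    using lin[OF x0] bij by (rule bij_linear_imp_linear_inv)
  note blR = linear_bounded_linear_frame[OF E linR]
  define m where "m x = (\<Sum>b\<in>E. norm b * norm (b - R (T x b)))" for x
  have "((\<lambda>x. \<Sum>b\<in>E. norm b * norm (b - R (T x b))) \<longlongrightarrow>
      (\<Sum>b\<in>E. norm b * norm (b - R (T x0 b)))) (at x0 within S)"
    using T x0 by (intro tendsto_intros bounded_linear.tendsto[OF blR]) (auto simp: continuous_on_def)
  then have m: "(m \<longlongrightarrow> 0) (at x0 within S)" by (simp add: m_def[abs_def] RT)
  have dev: "norm (a - R (T x a)) \<le> norm a * m x" if "x \<in> S" for x a
  proof -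
    have "linear (\<lambda>a. a - R (T x a))"
      using lin[OF that] linR by (intro linear_compose_sub linear_compose[of "T x" R, unfolded o_def] linear_ident)
    then have "a - R (T x a) = (\<Sum>b\<in>E. (a \<bullet> b) *\<^sub>R (b - R (T x b)))"
      using linear_frame_expand[OF E] by blast
    also have "norm \<dots> \<le> (\<Sum>b\<in>E. norm a * (norm b * norm (b - R (T x b))))"
      by (rule sum_norm_le)
        (auto simp: mult.assoc[symmetric] intro!: mult_right_mono Cauchy_Schwarz_ineq2)
    finally show ?thesis by (simp add: m_def sum_distrib_left)
  qed
  have Rr: "((\<lambda>x. R (r x)) \<longlongrightarrow> R (r x0)) (at x0 within S)"
    using r x0 by (intro bounded_linear.tendsto[OF blR]) (auto simp: continuous_on_def)
  have "((\<lambda>x. 2 * norm (R (r x)) * m x) \<longlongrightarrow> 2 * norm (R (r x0)) * 0) (at x0 within S)"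
    by (intro tendsto_intros Rr m)
  then have lim0: "((\<lambda>x. 2 * norm (R (r x)) * m x) \<longlongrightarrow> 0) (at x0 within S)" by simp
  have "\<forall>\<^sub>F x in at x0 within S. m x < 1 / 2"
    using order_tendstoD(2)[OF m, of "1/2"] by simp
  moreover have "\<forall>\<^sub>F x in at x0 within S. x \<in> S"
    by (simp add: eventually_at_filter)
  ultimately have ev: "\<forall>\<^sub>F x in at x0 within S. norm (Y x - R (r x)) \<le> 2 * norm (R (r x)) * m x"
  proof eventually_elim
    case (elim x)
    have m0: "m x \<ge> 0" by (auto simp: m_def intro!: sum_nonneg)
    have d: "norm (Y x - R (r x)) \<le> norm (Y x) * m x"
      using dev[OF elim(2), of "Y x"] Y[OF elim(2)] by simp
    have "norm (Y x) \<le> norm (R (r x)) + norm (Y x - R (r x))"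
      by (metis add.commute diff_add_cancel norm_triangle_ineq)
    also have "\<dots> \<le> norm (R (r x)) + norm (Y x) * (1 / 2)"
      using d elim(1) mult_left_mono[of "m x" "1/2" "norm (Y x)"] by simp
    finally have "norm (Y x) \<le> 2 * norm (R (r x))" by simp
    with d show ?case using mult_right_mono[OF _ m0] order_trans by blast
  qed
  have "((\<lambda>x. Y x - R (r x)) \<longlongrightarrow> 0) (at x0 within S)"
    by (rule Lim_null_comparison[OF ev lim0])
  from tendsto_add[OF this Rr] show "(Y \<longlongrightarrow> Y x0) (at x0 within S)"
    using Y[OF x0] RT[of "Y x0"] by simp
qed

text \<open>
  Once \<open>Y\<close> is continuous, it is differentiable, and differentiating \<open>T x (Y x) = r x\<close> shows that each
  directional derivative of \<open>Y\<close> solves a system with the same operators \<open>T x\<close> and a right-hand side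
  containing \<open>r'\<close>, the derivative of \<open>T\<close> and \<open>Y\<close> itself. This right-hand side is one order less
  smooth, so the induction on \<open>k\<close> applies to it.
\<close>

lemma Ck_on_linear_solution:
  fixes E :: "'e::real_inner set" and T :: "'p::real_normed_vector \<Rightarrow> 'e \<Rightarrow> 'e"
  assumes E: "finite_frame E"
    and lin: "\<And>x. x \<in> S \<Longrightarrow> linear (T x)" and inj: "\<And>x. x \<in> S \<Longrightarrow> inj (T x)"
    and "\<And>a. Ck_on k S (\<lambda>x. T x a)"
    and "Ck_on k S r" and "\<And>x. x \<in> S \<Longrightarrow> T x (Y x) = r x"
  shows "Ck_on k S Y"
  using assms(4-)
proof (induction k arbitrary: r Y)
  case 0
  then show ?case
    unfolding Ck_on.simps
    by - (rule linear_solution_continuous_on[where T = T and r = r, OF E]; simp add: lin inj)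
next
  case (Suc k)
  have Tk: "Ck_on k S (\<lambda>x. T x a)" for a using Suc.prems by (blast intro: Ck_on_Suc_D)
  have Yk: "Ck_on k S Y" using Suc.IH[of r Y] Suc.prems Ck_on_Suc_D by blast
  have Yc: "continuous_on S Y" using Yk by (rule Ck_on_imp_continuous_on)
  from Suc.prems(1) have "\<forall>a. \<exists>T'. (\<forall>x\<in>S. ((\<lambda>x. T x a) has_derivative T' x) (at x within S)) \<and>
      (\<forall>v. Ck_on k S (\<lambda>x. T' x v))" by simp
  then obtain T' where T': "\<And>a x. x \<in> S \<Longrightarrow> ((\<lambda>x. T x a) has_derivative T' a x) (at x within S)"
    "\<And>a v. Ck_on k S (\<lambda>x. T' a x v)"
    by metis
  from Suc.prems(2) obtain r' where r': "\<And>x. x \<in> S \<Longrightarrow> (r has_derivative r' x) (at x within S)"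
    "\<And>v. Ck_on k S (\<lambda>x. r' x v)" by auto
  define q where "q v x = r' x v + (\<Sum>b\<in>E. (Y x \<bullet> (- b)) *\<^sub>R T' b x v)" for v x
  define Y' where "Y' x v = inv (T x) (q v x)" for x v
  have bij: "bij (T x)" if "x \<in> S" for x
    using linear_injective_imp_bij_frame[OF E lin inj] that by blast
  have "(Y has_derivative Y' x0) (at x0 within S)" if x0: "x0 \<in> S" for x0
  proof -
    define R where "R = inv (T x0)"
    have RT: "R (T x0 a) = a" for a using bij[OF x0] by (simp add: R_def bij_is_inj)
    have linR: "linear R" unfolding R_def
      using lin[OF x0] bij[OF x0] by (rule bij_linear_imp_linear_inv)
    note blR = linear_bounded_linear_frame[OF E linR]
    \<comment> \<open>The coefficients \<open>Y x \<bullet> b\<close> are only known to be continuous, but they multiply functions that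
      vanish at \<open>x0\<close>.\<close>
    have Yx: "Y x = R (r x) + (\<Sum>b\<in>E. (Y x \<bullet> b) *\<^sub>R (b - R (T x b)))" if "x \<in> S" for x
    proof -
      have "linear (\<lambda>a. a - R (T x a))"
        using lin[OF that] linR by (intro linear_compose_sub linear_compose[of "T x" R, unfolded o_def] linear_ident)
      then have "Y x - R (T x (Y x)) = (\<Sum>b\<in>E. (Y x \<bullet> b) *\<^sub>R (b - R (T x b)))"
        using linear_frame_expand[OF E] by blast
      then show ?thesis using Suc.prems(3)[OF that] by (simp add: algebra_simps)
    qed
    have summand: "((\<lambda>x. (Y x \<bullet> b) *\<^sub>R (b - R (T x b))) has_derivative
        (\<lambda>v. (Y x0 \<bullet> b) *\<^sub>R (0 - R (T' b x0 v)))) (at x0 within S)" for b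
    proof (rule has_derivative_vanishing_times_continuous)
      show "((\<lambda>x. b - R (T x b)) has_derivative (\<lambda>v. 0 - R (T' b x0 v))) (at x0 within S)"
        by (intro has_derivative_diff has_derivative_const bounded_linear.has_derivative[OF blR] T' x0)
      show "b - R (T x0 b) = 0" by (simp add: RT)
      show "continuous (at x0 within S) (\<lambda>y. Y y \<bullet> b)"
        using Yc x0 by (auto simp: continuous_on_eq_continuous_within intro: continuous_intros)
    qed
    have D: "((\<lambda>x. R (r x) + (\<Sum>b\<in>E. (Y x \<bullet> b) *\<^sub>R (b - R (T x b)))) has_derivative
       (\<lambda>v. R (r' x0 v) + (\<Sum>b\<in>E. (Y x0 \<bullet> b) *\<^sub>R (0 - R (T' b x0 v))))) (at x0 within S)"
      by (intro has_derivative_add has_derivative_sum summand bounded_linear.has_derivative[OF blR] r' x0)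
    have "(\<lambda>v. R (r' x0 v) + (\<Sum>b\<in>E. (Y x0 \<bullet> b) *\<^sub>R (0 - R (T' b x0 v)))) = Y' x0"
      by (rule ext) (simp add: Y'_def q_def R_def[symmetric] linear_add[OF linR] linear_sum[OF linR]
          linear_scale[OF linR] linear_neg[OF linR])
    with has_derivative_transform[OF x0 Yx D] show ?thesis by (simp only:)
  qed
  moreover have "Ck_on k S (\<lambda>x. Y' x v)" for v
  proof (rule Suc.IH)
    show "Ck_on k S (\<lambda>x. T x a)" for a by (rule Tk)
    show "Ck_on k S (q v)" unfolding q_def
      by (intro Ck_on_add Ck_on_sum Ck_on_scaleR Ck_on_bounded_linear_compose[OF bounded_linear_inner_left] r' T' Yk)
    show "T x (Y' x v) = q v x" if "x \<in> S" for x
      using bij[OF that] by (simp add: Y'_def bij_is_surj surj_f_inv_f)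
  qed
  ultimately show ?case by auto
qed

section \<open>Smooth maps\<close>

lemma smooth_on_cong: "(\<And>x. x \<in> S \<Longrightarrow> f x = g x) \<Longrightarrow> smooth_on S f \<longleftrightarrow> smooth_on S g"
  unfolding smooth_on_def using Ck_on_cong by blast

lemma smooth_on_subset: "smooth_on S f \<Longrightarrow> T \<subseteq> S \<Longrightarrow> smooth_on T f"
  unfolding smooth_on_def using Ck_on_subset by blast

lemma smooth_on_compose:
  fixes E :: "'e::real_inner set" and f :: "'a::real_normed_vector \<Rightarrow> 'e"
  assumes "finite_frame E" "smooth_on T g" "smooth_on S f" "f ` S \<subseteq> T"
  shows "smooth_on S (\<lambda>x. g (f x))"
  using assms Ck_on_compose unfolding smooth_on_def by blast

lemma smooth_on_imp_continuous_on: "smooth_on S f \<Longrightarrow> continuous_on S f"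
  unfolding smooth_on_def using Ck_on_imp_continuous_on by blast

lemma smooth_on_has_frechet_derivative:
  assumes "smooth_on S f" "open S" "x \<in> S"
  shows "(f has_derivative frechet_derivative f (at x)) (at x)"
proof -
  have "Ck_on (Suc 0) S f" using assms(1) unfolding smooth_on_def by blast
  then obtain f' where "(f has_derivative f' x) (at x within S)"
    using assms(3) unfolding Ck_on.simps by blast
  then have "f differentiable (at x)"
    unfolding differentiable_def at_within_open[OF assms(3,2)] by blast
  then show ?thesis by (simp only: frechet_derivative_works)
qed

lemma smooth_on_frechet_derivative:
  assumes "smooth_on S f" "open S"
  shows "smooth_on S (\<lambda>x. frechet_derivative f (at x) v)"
  unfolding smooth_on_def
proof
  fix k
  have "Ck_on (Suc k) S f" using assms(1) unfolding smooth_on_def by blast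
  then obtain f' where f'S: "\<And>x. x \<in> S \<Longrightarrow> (f has_derivative f' x) (at x within S)"
    and k: "Ck_on k S (\<lambda>x. f' x v)"
    unfolding Ck_on.simps by blast
  have f': "(f has_derivative f' x) (at x)" if "x \<in> S" for x
    using f'S[OF that] unfolding at_within_open[OF that assms(2)] .
  show "Ck_on k S (\<lambda>x. frechet_derivative f (at x) v)"
    by (rule Ck_on_cong_imp[OF k]) (simp only: frechet_derivative_at[OF f', symmetric])
qed

section \<open>Gluing and partial derivatives\<close>

text \<open>
  Derivatives within such a set are unique, since each coordinate direction can be approached
  inside the set; the sign of \<open>d\<close> is left open to admit boundary points.
\<close>

definition axis_accessible :: "'a::euclidean_space set \<Rightarrow> bool" where
  "axis_accessible S \<longleftrightarrow>
     (\<forall>x\<in>S. \<forall>i\<in>Basis. \<forall>e>0. \<exists>d. 0 < \<bar>d\<bar> \<and> \<bar>d\<bar> < e \<and> x + d *\<^sub>R i \<in> S)"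

lemma axis_accessible_strip:
  assumes "openin (top_of_set ({-\<epsilon><..<\<epsilon>} \<times> {0..1})) (S :: (real \<times> real) set)"
  shows "axis_accessible S"
  unfolding axis_accessible_def
proof (intro ballI allI impI)
  fix x i :: "real \<times> real" and e :: real
  assume x: "x \<in> S" and i: "i \<in> Basis" and e: "e > 0"
  obtain s t where st: "x = (s, t)" by force
  have S: "S \<subseteq> {-\<epsilon><..<\<epsilon>} \<times> {0..1}" using assms openin_imp_subset by blast
  obtain r where r: "r > 0" "\<And>y. y \<in> {-\<epsilon><..<\<epsilon>} \<times> {0..1} \<Longrightarrow> dist y x < r \<Longrightarrow> y \<in> S"
    using assms x by (auto simp: openin_euclidean_subtopology_iff)
  have s: "-\<epsilon> < s" "s < \<epsilon>" and t: "0 \<le> t" "t \<le> 1" using S x st by auto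
  consider "i = (1, 0)" | "i = (0, 1)" using i by (auto simp: Basis_prod_def)
  then show "\<exists>d. 0 < \<bar>d\<bar> \<and> \<bar>d\<bar> < e \<and> x + d *\<^sub>R i \<in> S"
  proof cases
    case 1
    define d where "d = min (min e r) (\<epsilon> - s) / 2"
    have "0 < d" "d < e" "d < r" "d < \<epsilon> - s" using e r(1) s by (auto simp: d_def)
    then show ?thesis using s t
      by (intro exI[of _ d]) (auto simp: 1 st dist_Pair_Pair dist_real_def intro!: r(2))
  next
    case 2
    define d where "d = (if t < 1 then min (min e r) (1 - t) / 2 else - (min (min e r) 1 / 2))"
    have "0 < \<bar>d\<bar>" "\<bar>d\<bar> < e" "\<bar>d\<bar> < r" "0 \<le> t + d" "t + d \<le> 1"
      using e r(1) t by (cases "t < 1"; auto simp: d_def min_def field_simps)+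
    then show ?thesis using s t
      by (intro exI[of _ d]) (auto simp: 2 st dist_Pair_Pair dist_real_def intro!: r(2))
  qed
qed

text \<open>
  A \<open>C\<^sup>k\<close> map comes with some choice of derivative on each piece. Uniqueness of the derivative
  within the union makes the two choices agree on the overlap, so they combine to one derivative.
\<close>

lemma Ck_on_Un_open:
  fixes f :: "'a::euclidean_space \<Rightarrow> 'b::real_normed_vector"
  assumes acc: "axis_accessible (S \<union> T)"
    and S: "openin (top_of_set (S \<union> T)) S" and T: "openin (top_of_set (S \<union> T)) T"
    and "Ck_on k S f" and "Ck_on k T f"
  shows "Ck_on k (S \<union> T) f"
  using assms(4,5)
proof (induction k arbitrary: f)
  case 0
  then show ?case using continuous_on_Un_local_open[OF S T] by simp
next
  case (Suc k)
  from Suc.prems obtain f1 f2 where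
    f1: "\<And>x. x \<in> S \<Longrightarrow> (f has_derivative f1 x) (at x within S)" "\<And>v. Ck_on k S (\<lambda>x. f1 x v)" and
    f2: "\<And>x. x \<in> T \<Longrightarrow> (f has_derivative f2 x) (at x within T)" "\<And>v. Ck_on k T (\<lambda>x. f2 x v)"
    unfolding Ck_on.simps by metis
  have wi: "at x within (S \<union> T) = at x within R"
    if "openin (top_of_set (S \<union> T)) R" "x \<in> R" for x R
  proof -
    obtain O' where "open O'" "R = (S \<union> T) \<inter> O'" using \<open>openin _ R\<close> by (auto simp: openin_open)
    then show ?thesis using that(2) by (intro at_within_nhd[of x O']) auto
  qed
  have uniq: "f1 x = f2 x" if "x \<in> S" "x \<in> T" for x
  proof (rule frechet_derivative_unique_within)
    show "(f has_derivative f1 x) (at x within (S \<union> T))" using f1(1) that wi[OF S] by simp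
    show "(f has_derivative f2 x) (at x within (S \<union> T))" using f2(1) that wi[OF T] by simp
    show "\<And>i e. i \<in> Basis \<Longrightarrow> e > 0 \<Longrightarrow> \<exists>d. 0 < \<bar>d\<bar> \<and> \<bar>d\<bar> < e \<and> x + d *\<^sub>R i \<in> S \<union> T"
      using acc that by (auto simp: axis_accessible_def)
  qed
  define f' where "f' x = (if x \<in> S then f1 x else f2 x)" for x
  have f': "x \<in> S \<Longrightarrow> f' x = f1 x" "x \<in> T \<Longrightarrow> f' x = f2 x" for x
    using uniq by (auto simp: f'_def)
  have "(f has_derivative f' x) (at x within (S \<union> T))" if "x \<in> S \<union> T" for x
    using that f1(1) f2(1) wi[OF S] wi[OF T] f' by auto
  moreover have "Ck_on k (S \<union> T) (\<lambda>x. f' x v)" for v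
    by (rule Suc.IH; (rule Ck_on_cong_imp[OF f1(2)] Ck_on_cong_imp[OF f2(2)])) (auto simp: f')
  ultimately show ?case by auto
qed

text \<open>
  At boundary times of \<open>J\<close> only a derivative within \<open>W\<close> is available, but in the first variable \<open>W\<close> is
  open, so the partial derivative is two-sided.
\<close>

lemma Ck_on_partial_derivative:
  fixes F :: "real \<times> real \<Rightarrow> 'b::real_normed_vector"
  assumes F: "Ck_on (Suc 0) W F" and I: "open I" and W: "openin (top_of_set (I \<times> J)) W"
  shows "(s, t) \<in> W \<Longrightarrow>
      ((\<lambda>s. F (s, t)) has_vector_derivative vector_derivative (\<lambda>s. F (s, t)) (at s)) (at s)"
    and "continuous_on W (\<lambda>(s, t). vector_derivative (\<lambda>s. F (s, t)) (at s))"
proof -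
  obtain F' where F': "\<And>x. x \<in> W \<Longrightarrow> (F has_derivative F' x) (at x within W)"
    "\<And>v. continuous_on W (\<lambda>x. F' x v)" using F by auto
  have *: "((\<lambda>s. F (s, t)) has_vector_derivative F' (s, t) (1, 0)) (at s)" if st: "(s, t) \<in> W" for s t
  proof -
    obtain W' where W': "open W'" "W = (I \<times> J) \<inter> W'" using W by (auto simp: openin_open)
    define Q where "Q = I \<inter> (\<lambda>s. (s, t)) -` W'"
    have "open Q" unfolding Q_def
      by (intro open_Int I continuous_open_vimage W') (auto intro: continuous_intros)
    have QW: "(\<lambda>s. (s, t)) ` Q \<subseteq> W" using st W' by (auto simp: Q_def)
    have sQ: "s \<in> Q" using st W' by (auto simp: Q_def)
    have "(F has_derivative F' (s, t)) (at (s, t) within (\<lambda>s. (s, t)) ` Q)"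
      using F'(1)[OF st] QW by (rule has_derivative_subset)
    moreover have "((\<lambda>s. (s, t)) has_derivative (\<lambda>v. (v, 0))) (at s within Q)"
      by (intro has_derivative_Pair has_derivative_ident has_derivative_const)
    ultimately have d: "((\<lambda>s. F (s, t)) has_derivative (\<lambda>v. F' (s, t) (v, 0))) (at s within Q)"
      using has_derivative_in_compose[of "\<lambda>s. (s, t)" "\<lambda>v. (v, 0)" s Q F] by simp
    have lin: "linear (F' (s, t))" using F'(1)[OF st] has_derivative_linear by blast
    have "(\<lambda>v. F' (s, t) (v, 0)) = (\<lambda>v. v *\<^sub>R F' (s, t) (1, 0))"
    proof
      fix v :: real
      have "F' (s, t) (v *\<^sub>R (1, 0)) = v *\<^sub>R F' (s, t) (1, 0)" by (rule linear_scale[OF lin])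
      then show "F' (s, t) (v, 0) = v *\<^sub>R F' (s, t) (1, 0)"
        by (simp only: scaleR_Pair real_scaleR_def mult_1_right mult_zero_right)
    qed
    with d show ?thesis
      unfolding has_vector_derivative_def at_within_open[OF sQ \<open>open Q\<close>] by (simp only:)
  qed
  show "(s, t) \<in> W \<Longrightarrow>
      ((\<lambda>s. F (s, t)) has_vector_derivative vector_derivative (\<lambda>s. F (s, t)) (at s)) (at s)"
    using * by (metis vector_derivative_at)
  show "continuous_on W (\<lambda>(s, t). vector_derivative (\<lambda>s. F (s, t)) (at s))"
    by (rule continuous_on_eq[OF F'(2)[of "(1, 0)"]]) (use * vector_derivative_at in force)
qed

section \<open>A smooth bump function\<close>

text \<open>
  The functions \<open>exp (- 1 / x) / x\<^sup>n\<close>, extended by 0: a family closed under differentiation up to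
  linear combinations, which allows an induction over the order of smoothness.
\<close>

definition flat_exp :: "nat \<Rightarrow> real \<Rightarrow> real" where
  "flat_exp n x = (if x > 0 then exp (- 1 / x) / x ^ n else 0)"

lemma flat_exp_has_real_derivative:
  "(flat_exp n has_real_derivative (flat_exp (n + 2) x - real n * flat_exp (n + 1) x)) (at x)"
proof -
  consider "x < 0" | "x = 0" | "x > 0" by linarith
  then show ?thesis
  proof cases
    case 1
    have "((\<lambda>_. 0) has_real_derivative 0) (at x)" by simp
    then have "(flat_exp n has_real_derivative 0) (at x)"
      by (rule has_field_derivative_transform_within_open[of _ _ _ "{..<0}"])
         (use 1 in \<open>auto simp: flat_exp_def\<close>)
    then show ?thesis using 1 by (simp add: flat_exp_def)
  next
    case 3
    have e: "((\<lambda>x. exp (- 1 / x)) has_real_derivative exp (- 1 / x) / (x * x)) (at x)"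
      using 3 by (auto intro!: derivative_eq_intros)
    have "((\<lambda>x. exp (- 1 / x) / x ^ n) has_real_derivative
        (exp (- 1 / x) / (x * x) * x ^ n - exp (- 1 / x) * (real n * x ^ (n - 1))) / (x ^ n * x ^ n)) (at x)"
      using 3 DERIV_divide[OF e DERIV_pow[of n x]] by simp
    also have "(exp (- 1 / x) / (x * x) * x ^ n - exp (- 1 / x) * (real n * x ^ (n - 1))) / (x ^ n * x ^ n)
        = flat_exp (n + 2) x - real n * flat_exp (n + 1) x"
      using 3 by (cases n) (simp_all add: flat_exp_def divide_simps, simp add: algebra_simps)
    finally have "((\<lambda>x. exp (- 1 / x) / x ^ n) has_real_derivative
        (flat_exp (n + 2) x - real n * flat_exp (n + 1) x)) (at x)" .
    then show ?thesis
      by (rule has_field_derivative_transform_within_open[of _ _ _ "{0<..}"])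
         (use 3 in \<open>auto simp: flat_exp_def\<close>)
  next
    case 2
    \<comment> \<open>The difference quotient of \<open>flat_exp n\<close> at 0 is \<open>flat_exp (Suc n)\<close>.\<close>
    have "((\<lambda>x::real. exp (- 1 / x) / x ^ Suc n) \<longlongrightarrow> 0) (at_right 0)"
      by real_asymp
    then have "(flat_exp (Suc n) \<longlongrightarrow> 0) (at_right 0)"
      by (rule Lim_transform_eventually)
         (auto simp: flat_exp_def eventually_at_right_less intro: eventually_mono[OF eventually_at_right_less])
    moreover have "(flat_exp (Suc n) \<longlongrightarrow> 0) (at_left 0)"
      by (rule tendsto_eventually) (auto simp: flat_exp_def eventually_at_filter)
    ultimately have "(flat_exp (Suc n) \<longlongrightarrow> 0) (at 0)"
      by (simp add: filterlim_split_at)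
    then have "((\<lambda>y. (flat_exp n y - flat_exp n 0) / (y - 0)) \<longlongrightarrow> 0) (at 0)"
      by (rule Lim_transform_eventually) (auto simp: flat_exp_def eventually_at_filter divide_simps)
    then show ?thesis by (simp add: 2 has_field_derivative_iff flat_exp_def)
  qed
qed

lemma Ck_on_flat_exp: "Ck_on k S (flat_exp n)"
proof (induction k arbitrary: n)
  case 0
  have "continuous_on S (flat_exp n)"
    by (intro continuous_at_imp_continuous_on ballI DERIV_isCont[OF flat_exp_has_real_derivative])
  then show ?case by simp
next
  case (Suc k)
  show ?case unfolding Ck_on.simps
  proof (intro exI[of _ "\<lambda>x v. v *\<^sub>R (flat_exp (n + 2) x + (- real n) *\<^sub>R flat_exp (n + 1) x)"] conjI ballI allI)
    show "(flat_exp n has_derivative (\<lambda>v. v *\<^sub>R (flat_exp (n + 2) x + (- real n) *\<^sub>R flat_exp (n + 1) x))) (at x within S)" for x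
      using has_field_derivative_at_within[OF flat_exp_has_real_derivative[of n x], of S]
      by (simp add: has_field_derivative_def mult.commute[of _ "_ - _"] mult_commute_abs)
    show "Ck_on k S (\<lambda>x. v *\<^sub>R (flat_exp (n + 2) x + (- real n) *\<^sub>R flat_exp (n + 1) x))" for v
      by (intro Ck_on_scaleR Ck_on_add Ck_on_const Suc.IH)
  qed
qed

lemma smooth_bump_exists:
  fixes \<alpha> \<beta> :: real
  obtains \<rho> :: "real \<Rightarrow> real" where "\<And>k S. Ck_on k S \<rho>" "\<And>t. 0 \<le> \<rho> t" "\<And>t. \<rho> t \<le> 1"
    "\<And>t. \<rho> t \<noteq> 0 \<longleftrightarrow> \<alpha> < t \<and> t < \<beta>"
proof
  let ?\<rho> = "\<lambda>t. flat_exp 0 (t + (- \<alpha>)) *\<^sub>R flat_exp 0 ((- 1) *\<^sub>R t + \<beta>)"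
  show "Ck_on k S ?\<rho>" for k S
    by (intro Ck_on_scaleR Ck_on_compose[OF finite_frame_Basis Ck_on_flat_exp[where S = UNIV]] Ck_on_add Ck_on_const
        Ck_on_bounded_linear[OF bounded_linear_ident] Ck_on_bounded_linear[OF bounded_linear_scaleR_right]
        subset_UNIV)
  have f: "0 \<le> flat_exp 0 x" "flat_exp 0 x \<le> 1" for x by (auto simp: flat_exp_def)
  show "0 \<le> ?\<rho> t" for t using f by simp
  show "?\<rho> t \<le> 1" for t by (auto intro!: mult_le_one f)
  show "?\<rho> t \<noteq> 0 \<longleftrightarrow> \<alpha> < t \<and> t < \<beta>" for t by (auto simp: flat_exp_def)
qed

section \<open>Charts and tangent vectors\<close>

text \<open>
  The frame is a parameter because the smoothness arguments expand vectors of the model space in it.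
\<close>

locale framed_manifold =
  fixes X :: "'m topology" and A :: "('m, 'e::real_inner) chart set" and E :: "'e set"
  assumes mfd: "smooth_manifold X A" and E: "finite_frame E"
begin

lemma atlas: "smooth_atlas X A"
  using mfd by (simp add: smooth_manifold_def)

lemma chart_openin: "c \<in> A \<Longrightarrow> openin X (fst c)"
  using atlas unfolding smooth_atlas_def by (cases c) auto

lemma chart_open_image: "c \<in> A \<Longrightarrow> open (snd c ` fst c)"
  using atlas unfolding smooth_atlas_def by (cases c) auto

lemma chart_homeomorphic:
  "c \<in> A \<Longrightarrow> homeomorphic_map (subtopology X (fst c)) (top_of_set (snd c ` fst c)) (snd c)"
  using atlas unfolding smooth_atlas_def by (cases c) auto

lemma topspace_chart: "c \<in> A \<Longrightarrow> topspace (subtopology X (fst c)) = fst c"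
  using openin_subset[OF chart_openin, of c] by (simp add: Int_absorb1)

lemma chart_subset: "c \<in> A \<Longrightarrow> fst c \<subseteq> topspace X"
  using chart_openin openin_subset by blast

lemma chart_inj: "c \<in> A \<Longrightarrow> inj_on (snd c) (fst c)"
  using homeomorphic_imp_injective_map[OF chart_homeomorphic] topspace_chart by metis

lemma chart_inv_left: "c \<in> A \<Longrightarrow> p \<in> fst c \<Longrightarrow> chart_inv c (snd c p) = p"
  using chart_inj by simp

lemma chart_inv_mem: "x \<in> snd c ` fst c \<Longrightarrow> chart_inv c x \<in> fst c"
  by (rule inv_into_into)

lemma chart_inv_right: "x \<in> snd c ` fst c \<Longrightarrow> snd c (chart_inv c x) = x"
  by (rule f_inv_into_f)

lemma chart_at:
  assumes "p \<in> topspace X"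
  obtains c where "c \<in> A" "p \<in> fst c"
proof -
  have "p \<in> (\<Union>(U, \<phi>)\<in>A. U)" using assms atlas by (simp add: smooth_atlas_def)
  then show ?thesis using that by fastforce
qed

lemma overlap_open:
  assumes "c \<in> A" and "d \<in> A"
  shows "open (snd c ` (fst c \<inter> fst d))"
proof -
  have "openin (subtopology X (fst c)) (fst c \<inter> fst d)"
    using chart_openin[OF assms(2)] by (auto simp: openin_subtopology)
  then have "openin (top_of_set (snd c ` fst c)) (snd c ` (fst c \<inter> fst d))"
    using homeomorphic_imp_open_map[OF chart_homeomorphic[OF assms(1)]] by (simp add: open_map_def)
  then show ?thesis using chart_open_image[OF assms(1)] openin_open_eq by blast
qed

lemma continuous_map_chart_inv:
  assumes "c \<in> A"
  shows "continuous_map (top_of_set (snd c ` fst c)) X (chart_inv c)"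
proof -
  obtain g where g: "homeomorphic_maps (subtopology X (fst c)) (top_of_set (snd c ` fst c)) (snd c) g"
    using chart_homeomorphic[OF assms] by (auto simp: homeomorphic_map_maps)
  have "continuous_map (top_of_set (snd c ` fst c)) X g"
    using g continuous_map_into_fulltopology by (auto simp: homeomorphic_maps_def)
  moreover have "g x = chart_inv c x" if "x \<in> topspace (top_of_set (snd c ` fst c))" for x
  proof -
    obtain p where p: "p \<in> fst c" "x = snd c p" using \<open>x \<in> _\<close> by auto
    then have "g x = p" using g topspace_chart[OF assms] by (auto simp: homeomorphic_maps_def)
    then show ?thesis using p chart_inv_left[OF assms] by simp
  qed
  ultimately show ?thesis by (rule continuous_map_eq)
qed

lemma transition_smooth:
  "c \<in> A \<Longrightarrow> d \<in> A \<Longrightarrow> smooth_on (snd c ` (fst c \<inter> fst d)) (snd d \<circ> chart_inv c)"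
  using atlas unfolding smooth_atlas_def by (cases c; cases d) auto

lemma transition_has_derivative:
  assumes "c \<in> A" "d \<in> A" "p \<in> fst c" "p \<in> fst d"
  shows "((snd d \<circ> chart_inv c) has_derivative transition_deriv c d p) (at (snd c p))"
  unfolding transition_deriv_def
  by (rule smooth_on_has_frechet_derivative[OF transition_smooth overlap_open]) (use assms in auto)

text \<open>
  The chain rule for a change of chart, for maps into any normed space. With a chart for \<open>F\<close> it yields
  the cocycle rule of the transition derivatives, with a real function for \<open>F\<close> the independence of
  the differential from the chart.
\<close>

lemma has_derivative_change_chart:
  fixes F :: "'m \<Rightarrow> 'b::real_normed_vector"
  assumes cd: "c \<in> A" "d \<in> A" "p \<in> fst c" "p \<in> fst d"
    and F: "((F \<circ> chart_inv d) has_derivative G) (at (snd d p))"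
  shows "((F \<circ> chart_inv c) has_derivative (\<lambda>a. G (transition_deriv c d p a))) (at (snd c p))"
proof -
  have "(snd d \<circ> chart_inv c) (snd c p) = snd d p" using cd chart_inv_left by simp
  then have "((F \<circ> chart_inv d) has_derivative G) (at ((snd d \<circ> chart_inv c) (snd c p)))"
    using F by simp
  from diff_chain_at[OF transition_has_derivative[OF cd] this]
  have "((F \<circ> chart_inv d) \<circ> (snd d \<circ> chart_inv c) has_derivative G \<circ> transition_deriv c d p) (at (snd c p))" .
  then have "((F \<circ> chart_inv c) has_derivative G \<circ> transition_deriv c d p) (at (snd c p))"
  proof (rule has_derivative_transform_within_open[OF _ overlap_open[OF cd(1,2)]])
    show "snd c p \<in> snd c ` (fst c \<inter> fst d)" using cd by auto
    fix x assume "x \<in> snd c ` (fst c \<inter> fst d)"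
    then obtain q where "q \<in> fst c" "q \<in> fst d" "x = snd c q" by auto
    then show "(F \<circ> chart_inv d \<circ> (snd d \<circ> chart_inv c)) x = (F \<circ> chart_inv c) x"
      using cd chart_inv_left by simp
  qed
  then show ?thesis by (simp add: o_def)
qed

lemma transition_deriv_comp:
  assumes "c \<in> A" "d \<in> A" "e \<in> A" "p \<in> fst c" "p \<in> fst d" "p \<in> fst e"
  shows "transition_deriv d e p (transition_deriv c d p a) = transition_deriv c e p a"
proof -
  have "((snd e \<circ> chart_inv c) has_derivative (\<lambda>a. transition_deriv d e p (transition_deriv c d p a))) (at (snd c p))"
    using has_derivative_change_chart[of c d p "snd e"] transition_has_derivative[of d e p] assms by blast
  from has_derivative_unique[OF this transition_has_derivative[of c e p]] assms
  show ?thesis by metis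
qed

lemma transition_deriv_self:
  assumes "c \<in> A" "p \<in> fst c"
  shows "transition_deriv c c p a = a"
proof -
  have "((\<lambda>x. x) has_derivative (\<lambda>x. x)) (at (snd c p))" by simp
  then have "((snd c \<circ> chart_inv c) has_derivative (\<lambda>x. x)) (at (snd c p))"
    by (rule has_derivative_transform_within_open[OF _ chart_open_image[OF assms(1)]])
       (auto simp: chart_inv_left assms)
  from has_derivative_unique[OF this transition_has_derivative[of c c p]] assms
  show ?thesis by metis
qed

lemma linear_transition_deriv:
  assumes "c \<in> A" "d \<in> A" "p \<in> fst c" "p \<in> fst d"
  shows "linear (transition_deriv c d p)"
  using transition_has_derivative[OF assms] has_derivative_linear by blast

lemma tangent_of_coord_mem:
  "c \<in> A \<Longrightarrow> p \<in> fst c \<Longrightarrow> tangent_of_coord A c p a \<in> tangent_space A p"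
  by (auto simp: tangent_of_coord_def tangent_space_def transition_deriv_comp)

lemma tangent_of_coord_self: "c \<in> A \<Longrightarrow> p \<in> fst c \<Longrightarrow> tangent_of_coord A c p a c = a"
  by (simp add: tangent_of_coord_def transition_deriv_self)

lemma tangent_transform:
  "v \<in> tangent_space A p \<Longrightarrow> c \<in> A \<Longrightarrow> d \<in> A \<Longrightarrow> p \<in> fst c \<Longrightarrow> p \<in> fst d \<Longrightarrow>
     v d = transition_deriv c d p (v c)"
  unfolding tangent_space_def by blast

lemma tangent_off_chart: "v \<in> tangent_space A p \<Longrightarrow> \<not> (c \<in> A \<and> p \<in> fst c) \<Longrightarrow> v c = 0"
  unfolding tangent_space_def by blast

lemma tangent_of_coord_eq:
  assumes "c \<in> A" "p \<in> fst c" "v \<in> tangent_space A p"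
  shows "tangent_of_coord A c p (v c) = v"
proof
  fix d
  show "tangent_of_coord A c p (v c) d = v d"
    using tangent_transform[OF assms(3,1) _ assms(2), of d] tangent_off_chart[OF assms(3), of d]
    by (simp add: tangent_of_coord_def)
qed

lemma tangent_eqI:
  assumes "c \<in> A" "p \<in> fst c" "v \<in> tangent_space A p" "w \<in> tangent_space A p" "v c = w c"
  shows "v = w"
  using assms tangent_of_coord_eq by metis

lemma tangent_lincomb:
  assumes "u \<in> tangent_space A p" "v \<in> tangent_space A p"
  shows "(\<lambda>c. r *\<^sub>R u c + s *\<^sub>R v c) \<in> tangent_space A p"
  unfolding tangent_space_def
proof (intro CollectI conjI ballI impI allI; (elim conjE)?)
  fix c d assume *: "c \<in> A" "d \<in> A" "p \<in> fst c" "p \<in> fst d"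
  note l = linear_transition_deriv[OF *]
  show "r *\<^sub>R u d + s *\<^sub>R v d = transition_deriv c d p (r *\<^sub>R u c + s *\<^sub>R v c)"
    unfolding linear_add[OF l] linear_scale[OF l]
    using tangent_transform[OF assms(1) *] tangent_transform[OF assms(2) *] by (simp only:)
next
  fix c assume "\<not> (c \<in> A \<and> p \<in> fst c)"
  then show "r *\<^sub>R u c + s *\<^sub>R v c = 0"
    using tangent_off_chart[OF assms(1), of c] tangent_off_chart[OF assms(2), of c] by simp
qed

lemma tangent_of_coord_lincomb:
  assumes "c \<in> A" "p \<in> fst c"
  shows "tangent_of_coord A c p (r *\<^sub>R a + s *\<^sub>R b) =
    (\<lambda>d. r *\<^sub>R tangent_of_coord A c p a d + s *\<^sub>R tangent_of_coord A c p b d)"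
  using assms linear_transition_deriv
  by (auto simp: tangent_of_coord_def linear_add linear_scale fun_eq_iff)

lemma smooth_fun_has_derivative:
  assumes "smooth_fun A f" "c \<in> A" "p \<in> fst c"
  shows "((f \<circ> chart_inv c) has_derivative frechet_derivative (f \<circ> chart_inv c) (at (snd c p))) (at (snd c p))"
  by (rule smooth_on_has_frechet_derivative[OF _ chart_open_image[OF assms(2)]])
    (use assms in \<open>auto simp: smooth_fun_def\<close>)

lemma differential_chart:
  assumes f: "smooth_fun A f" and c: "c \<in> A" "p \<in> fst c" and v: "v \<in> tangent_space A p"
  shows "differential A f p v = frechet_derivative (f \<circ> chart_inv c) (at (snd c p)) (v c)"
proof -
  define d where "d = (SOME c. c \<in> A \<and> p \<in> fst c)"
  have d: "d \<in> A" "p \<in> fst d" using someI[of "\<lambda>c. c \<in> A \<and> p \<in> fst c" c] c by (auto simp: d_def)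
  have "((f \<circ> chart_inv c) has_derivative
      (\<lambda>a. frechet_derivative (f \<circ> chart_inv d) (at (snd d p)) (transition_deriv c d p a))) (at (snd c p))"
    by (rule has_derivative_change_chart[OF c(1) d(1) c(2) d(2) smooth_fun_has_derivative[OF f d]])
  from has_derivative_unique[OF this smooth_fun_has_derivative[OF f c]]
  have "frechet_derivative (f \<circ> chart_inv d) (at (snd d p)) (transition_deriv c d p (v c)) =
     frechet_derivative (f \<circ> chart_inv c) (at (snd c p)) (v c)" by metis
  moreover have "v d = transition_deriv c d p (v c)"
    by (rule tangent_transform[OF v c(1) d(1) c(2) d(2)])
  ultimately show ?thesis by (simp add: differential_def Let_def flip: d_def)
qed

end

section \<open>Hamiltonian vector fields\<close>

locale framed_symplectic = framed_manifold X A E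
  for X :: "'m topology" and A :: "('m, 'e::real_inner) chart set" and E :: "'e set" +
  fixes \<omega> :: "('m, 'e) form2"
  assumes symplectic: "symplectic_form X A \<omega>"
begin

lemma form_lincomb_left:
  assumes "p \<in> topspace X" "u \<in> tangent_space A p" "v \<in> tangent_space A p" "w \<in> tangent_space A p"
  shows "\<omega> p (\<lambda>c. r *\<^sub>R u c + s *\<^sub>R v c) w = r * \<omega> p u w + s * \<omega> p v w"
  using assms symplectic unfolding symplectic_form_def smooth_2form_def by blast

lemma form_skew:
  assumes "p \<in> topspace X" "u \<in> tangent_space A p" "v \<in> tangent_space A p"
  shows "\<omega> p u v = - \<omega> p v u"
  using assms symplectic unfolding symplectic_form_def smooth_2form_def by blast

lemma form_lincomb_right:
  assumes "p \<in> topspace X" "u \<in> tangent_space A p" "v \<in> tangent_space A p" "w \<in> tangent_space A p"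
  shows "\<omega> p w (\<lambda>c. r *\<^sub>R u c + s *\<^sub>R v c) = r * \<omega> p w u + s * \<omega> p w v"
  using form_skew[OF assms(1,4) tangent_lincomb[OF assms(2,3), of r s]] form_skew[OF assms(1,4,2)]
    form_skew[OF assms(1,4,3)] form_lincomb_left[OF assms, of r s] by simp

lemma form_nondegenerate:
  assumes "p \<in> topspace X" "v \<in> tangent_space A p" "\<And>w. w \<in> tangent_space A p \<Longrightarrow> \<omega> p v w = 0"
  shows "v = (\<lambda>_. 0)"
  using assms symplectic unfolding symplectic_form_def nondegenerate_2form_def by blast

lemma form_chart:
  assumes "c \<in> A" "p \<in> fst c" "u \<in> tangent_space A p" "v \<in> tangent_space A p"
  shows "\<omega> p u v = form_in_chart A \<omega> c (snd c p) (u c) (v c)"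
  using assms by (simp add: form_in_chart_def chart_inv_left tangent_of_coord_eq)

lemma linear_form_in_chart:
  assumes c: "c \<in> A" and x: "x \<in> snd c ` fst c"
  shows "linear (\<lambda>a. form_in_chart A \<omega> c x a b)" and "linear (form_in_chart A \<omega> c x b)"
proof -
  define p where "p = chart_inv c x"
  have p: "p \<in> fst c" "p \<in> topspace X" using chart_inv_mem[OF x] chart_subset[OF c] by (auto simp: p_def)
  note m = tangent_of_coord_mem[OF c p(1)]
  have l: "form_in_chart A \<omega> c x (r *\<^sub>R a + s *\<^sub>R a') b = r * form_in_chart A \<omega> c x a b + s * form_in_chart A \<omega> c x a' b"
    for r s a a'
    using form_lincomb_left[OF p(2) m m m] by (simp add: form_in_chart_def tangent_of_coord_lincomb c p flip: p_def)
  have r: "form_in_chart A \<omega> c x b (r *\<^sub>R a + s *\<^sub>R a') = r * form_in_chart A \<omega> c x b a + s * form_in_chart A \<omega> c x b a'"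
    for r s a a'
    using form_lincomb_right[OF p(2) m m m] by (simp add: form_in_chart_def tangent_of_coord_lincomb c p flip: p_def)
  show "linear (\<lambda>a. form_in_chart A \<omega> c x a b)"
    using l[of 1 _ 1] l[of _ _ 0] by (intro linearI) auto
  show "linear (form_in_chart A \<omega> c x b)"
    using r[of 1 _ 1] r[of _ _ 0] by (intro linearI) auto
qed

text \<open>
  The endomorphism representing the form by the inner product of the model space: its inner product
  with \<open>w\<close> is the value of the form at \<open>a\<close> and \<open>w\<close>.
\<close>

definition form_operator :: "('m, 'e) chart \<Rightarrow> 'e \<Rightarrow> 'e \<Rightarrow> 'e" where
  "form_operator c x a = (\<Sum>b\<in>E. form_in_chart A \<omega> c x a b *\<^sub>R b)"

lemma inner_frame_sum:
  assumes "linear (l :: 'e \<Rightarrow> real)"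
  shows "(\<Sum>b\<in>E. l b *\<^sub>R b) \<bullet> w = l w"
proof -
  have "(\<Sum>b\<in>E. l b *\<^sub>R b) \<bullet> w = (\<Sum>b\<in>E. (w \<bullet> b) *\<^sub>R l b)"
    unfolding inner_sum_left by (intro sum.cong refl) (simp add: inner_commute)
  also have "\<dots> = l w" by (rule linear_frame_expand[OF E assms, symmetric])
  finally show ?thesis .
qed

lemma form_operator_inner:
  assumes "c \<in> A" and "x \<in> snd c ` fst c"
  shows "form_operator c x a \<bullet> w = form_in_chart A \<omega> c x a w"
  unfolding form_operator_def by (rule inner_frame_sum[OF linear_form_in_chart(2)[OF assms]])

lemma linear_form_operator:
  assumes "c \<in> A" and "x \<in> snd c ` fst c"
  shows "linear (form_operator c x)"
  by (rule linearI; subst vector_eq_rdot[symmetric])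
    (simp_all add: form_operator_inner[OF assms] inner_add_left linear_add[OF linear_form_in_chart(1)[OF assms]]
      linear_scale[OF linear_form_in_chart(1)[OF assms]])

lemma inj_form_operator:
  assumes c: "c \<in> A" and x: "x \<in> snd c ` fst c"
  shows "inj (form_operator c x)"
  unfolding linear_injective_0[OF linear_form_operator[OF assms]]
proof (intro allI impI)
  fix a assume 0: "form_operator c x a = 0"
  define p where "p = chart_inv c x"
  have p: "p \<in> fst c" "p \<in> topspace X" "snd c p = x"
    using chart_inv_mem[OF x] chart_inv_right[OF x] chart_subset[OF c] by (auto simp: p_def)
  have "tangent_of_coord A c p a = (\<lambda>_. 0)"
  proof (rule form_nondegenerate[OF p(2) tangent_of_coord_mem[OF c p(1)]])
    fix w assume w: "w \<in> tangent_space A p"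
    have "\<omega> p (tangent_of_coord A c p a) w = form_in_chart A \<omega> c x a (w c)"
      using form_chart[OF c p(1) tangent_of_coord_mem[OF c p(1)] w] tangent_of_coord_self[OF c p(1)] p(3) by simp
    also have "\<dots> = 0" using form_operator_inner[OF assms, of a "w c"] 0 by simp
    finally show "\<omega> p (tangent_of_coord A c p a) w = 0" .
  qed
  then show "a = 0" using tangent_of_coord_self[OF c p(1), of a] by simp
qed

text \<open>
  In coordinates the Hamiltonian equation is the linear system whose operator represents the form and
  whose right-hand side is minus the gradient of \<open>f\<close>.
\<close>

lemma hamiltonian_equation_chart:
  assumes f: "smooth_fun A f" and c: "c \<in> A" "p \<in> fst c" and v: "v \<in> tangent_space A p"
  shows "(\<forall>w\<in>tangent_space A p. \<omega> p v w = - differential A f p w) \<longleftrightarrow>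
    form_operator c (snd c p) (v c) =
      - (\<Sum>b\<in>E. frechet_derivative (f \<circ> chart_inv c) (at (snd c p)) b *\<^sub>R b)" (is "?L \<longleftrightarrow> _ = - ?g")
proof -
  let ?D = "frechet_derivative (f \<circ> chart_inv c) (at (snd c p))"
  have x: "snd c p \<in> snd c ` fst c" using c by auto
  have D: "linear ?D" using smooth_fun_has_derivative[OF f c] has_derivative_linear by blast
  have "?L \<longleftrightarrow> (\<forall>w\<in>tangent_space A p. form_operator c (snd c p) (v c) \<bullet> (w c) = - ?g \<bullet> (w c))"
    by (intro ball_cong refl)
      (simp add: form_chart[OF c v] form_operator_inner[OF c(1) x] inner_frame_sum[OF D] differential_chart[OF f c])
  also have "\<dots> \<longleftrightarrow> (\<forall>a. form_operator c (snd c p) (v c) \<bullet> a = - ?g \<bullet> a)"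
  proof (intro iffI allI)
    fix a
    assume H: "\<forall>w\<in>tangent_space A p. form_operator c (snd c p) (v c) \<bullet> (w c) = - ?g \<bullet> (w c)"
    show "form_operator c (snd c p) (v c) \<bullet> a = - ?g \<bullet> a"
      using bspec[OF H tangent_of_coord_mem[OF c, of a]] unfolding tangent_of_coord_self[OF c] .
  qed blast
  also have "\<dots> \<longleftrightarrow> form_operator c (snd c p) (v c) = - ?g"
    by (rule vector_eq_rdot)
  finally show ?thesis .
qed

lemma hamiltonian_vector_unique:
  assumes f: "smooth_fun A f" and p: "p \<in> topspace X"
  shows "\<exists>!v. v \<in> tangent_space A p \<and> (\<forall>w\<in>tangent_space A p. \<omega> p v w = - differential A f p w)"
proof -
  obtain c where c: "c \<in> A" "p \<in> fst c" using chart_at[OF p] .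
  let ?g = "\<Sum>b\<in>E. frechet_derivative (f \<circ> chart_inv c) (at (snd c p)) b *\<^sub>R b"
  have x: "snd c p \<in> snd c ` fst c" using c by auto
  have bij: "bij (form_operator c (snd c p))"
    by (rule linear_injective_imp_bij_frame[OF E linear_form_operator[OF c(1) x] inj_form_operator[OF c(1) x]])
  obtain a where a: "form_operator c (snd c p) a = - ?g"
    using surjD[OF bij_is_surj[OF bij], of "- ?g"] by (elim exE) (erule that[OF sym])
  show ?thesis
  proof (rule ex1I[of _ "tangent_of_coord A c p a"])
    show "tangent_of_coord A c p a \<in> tangent_space A p \<and>
       (\<forall>w\<in>tangent_space A p. \<omega> p (tangent_of_coord A c p a) w = - differential A f p w)"
      using hamiltonian_equation_chart[OF f c tangent_of_coord_mem[OF c]] a tangent_of_coord_mem[OF c]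
      by (simp add: tangent_of_coord_self[OF c])
  next
    fix v assume v: "v \<in> tangent_space A p \<and> (\<forall>w\<in>tangent_space A p. \<omega> p v w = - differential A f p w)"
    then have "form_operator c (snd c p) (v c) = form_operator c (snd c p) a"
      unfolding a using hamiltonian_equation_chart[OF f c, of v] by blast
    then have "v c = a" by (rule injD[OF bij_is_inj[OF bij]])
    with v show "v = tangent_of_coord A c p a" using tangent_of_coord_eq[OF c, of v] by simp
  qed
qed

text \<open>
  The pointwise solutions form a field that is smooth because its coordinates solve a linear system
  with smooth operators and a smooth right-hand side; as a field it is then the only solution, and the
  definite description denotes it.
\<close>

lemma hamiltonian_vf:
  assumes f: "smooth_fun A f"
  shows "vector_field X A (hamiltonian_vf X A \<omega> f)"
    and "p \<in> topspace X \<Longrightarrow> v \<in> tangent_space A p \<Longrightarrow>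
      \<omega> p (hamiltonian_vf X A \<omega> f p) v = - differential A f p v"
proof -
  let ?P = "\<lambda>p v. v \<in> tangent_space A p \<and> (\<forall>w\<in>tangent_space A p. \<omega> p v w = - differential A f p w)"
  let ?Q = "\<lambda>Y. vector_field X A Y \<and>
        (\<forall>p\<in>topspace X. \<forall>v\<in>tangent_space A p. \<omega> p (Y p) v = - differential A f p v)"
  define Y where "Y = (\<lambda>p\<in>topspace X. THE v. ?P p v)"
  have Y: "?P p (Y p)" if "p \<in> topspace X" for p
    using theI'[OF hamiltonian_vector_unique[OF f that]] that by (simp add: Y_def)
  have "smooth_on (snd c ` fst c) (\<lambda>x. Y (chart_inv c x) c)" if c: "c \<in> A" for c
    unfolding smooth_on_def
  proof
    fix k
    let ?g = "\<lambda>x. \<Sum>b\<in>E. frechet_derivative (f \<circ> chart_inv c) (at x) b *\<^sub>R (- b)"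
    show "Ck_on k (snd c ` fst c) (\<lambda>x. Y (chart_inv c x) c)"
    proof (rule Ck_on_linear_solution[OF E, of _ "form_operator c" _ ?g])
      show "Ck_on k (snd c ` fst c) (\<lambda>x. form_operator c x a)" for a
        using symplectic c unfolding form_operator_def
        by (intro Ck_on_sum Ck_on_scaleR Ck_on_const)
          (auto simp: symplectic_form_def smooth_2form_def smooth_on_def)
      have "smooth_on (snd c ` fst c) (f \<circ> chart_inv c)" using f c by (auto simp: smooth_fun_def)
      from smooth_on_frechet_derivative[OF this chart_open_image[OF c]]
      show "Ck_on k (snd c ` fst c) ?g"
        by (intro Ck_on_sum Ck_on_scaleR Ck_on_const) (auto simp: smooth_on_def)
      fix x assume x: "x \<in> snd c ` fst c"
      show "linear (form_operator c x)" "inj (form_operator c x)"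
        using linear_form_operator[OF c x] inj_form_operator[OF c x] by auto
      have p: "chart_inv c x \<in> fst c" "chart_inv c x \<in> topspace X"
        using chart_inv_mem[OF x] chart_subset[OF c] by auto
      show "form_operator c x (Y (chart_inv c x) c) = ?g x"
        using hamiltonian_equation_chart[OF f c p(1), of "Y (chart_inv c x)"] Y[OF p(2)] chart_inv_right[OF x]
        by (simp add: sum_negf)
    qed
  qed
  then have vf: "vector_field X A Y"
    unfolding vector_field_def using Y by (auto simp: Y_def)
  have Q: "?Q Y" using vf Y by blast
  have uniq: "Z = Y" if "?Q Z" for Z
  proof (rule extensionalityI[of _ "topspace X"])
    show "Z \<in> extensional (topspace X)" "Y \<in> extensional (topspace X)"
      using that vf by (auto simp: vector_field_def)
    fix p assume p: "p \<in> topspace X"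
    then have "?P p (Z p)" using that by (auto simp: vector_field_def)
    then show "Z p = Y p" using hamiltonian_vector_unique[OF f p] Y[OF p] by blast
  qed
  have eq: "hamiltonian_vf X A \<omega> f = Y"
    unfolding hamiltonian_vf_def by (rule the_equality) (fact Q, rule uniq)
  show "vector_field X A (hamiltonian_vf X A \<omega> f)" using vf eq by simp
  show "p \<in> topspace X \<Longrightarrow> v \<in> tangent_space A p \<Longrightarrow>
      \<omega> p (hamiltonian_vf X A \<omega> f p) v = - differential A f p v"
    using Y eq by simp
qed

end

section \<open>Smooth maps into a manifold\<close>

lemma continuous_on_locally:
  fixes f :: "'a::t2_space \<Rightarrow> 'b::topological_space"
  assumes "\<And>x. x \<in> S \<Longrightarrow> \<exists>J. openin (top_of_set S) J \<and> x \<in> J \<and> continuous_on J f"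
  shows "continuous_on S f"
  unfolding continuous_on_eq_continuous_within
proof
  fix x assume "x \<in> S"
  then obtain J where J: "openin (top_of_set S) J" "x \<in> J" "continuous_on J f" using assms by blast
  obtain T where T: "open T" "J = S \<inter> T" using J(1) by (auto simp: openin_open)
  have "at x within S = at x within J" using T J(2) by (intro at_within_nhd[of x T]) auto
  then show "continuous (at x within S) f"
    using J by (simp add: continuous_on_eq_continuous_within)
qed

context framed_manifold
begin

lemma smooth_into_topspace: "smooth_into X A S F \<Longrightarrow> x \<in> S \<Longrightarrow> F x \<in> topspace X"
  using continuous_map_image_subset_topspace unfolding smooth_into_def by fastforce

lemma smooth_into_preimage_openin:
  assumes "smooth_into X A S F" and "c \<in> A"
  shows "openin (top_of_set S) {x \<in> S. F x \<in> fst c}"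
  using openin_continuous_map_preimage[of "top_of_set S" X F "fst c"] assms chart_openin
  by (auto simp: smooth_into_def)

lemma smooth_into_chart:
  assumes "smooth_into X A S F" and "c \<in> A"
  shows "smooth_on {x \<in> S. F x \<in> fst c} (\<lambda>x. snd c (F x))"
  using assms unfolding smooth_into_def by (cases c) (auto simp: o_def)

lemma smooth_into_compose:
  fixes h :: "'p::real_normed_vector \<Rightarrow> 'q::real_inner"
  assumes "finite_frame (B :: 'q set)"
    and F: "smooth_into X A T F" and h: "smooth_on S h" "h ` S \<subseteq> T"
  shows "smooth_into X A S (\<lambda>x. F (h x))"
proof -
  have "continuous_map (top_of_set S) (top_of_set T) h"
    using smooth_on_imp_continuous_on[OF h(1)] h(2) by auto
  then have "continuous_map (top_of_set S) X (\<lambda>x. F (h x))"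
    using F continuous_map_compose[of "top_of_set S" "top_of_set T" h X F]
    by (simp add: smooth_into_def o_def)
  moreover have "smooth_on {x \<in> S. F (h x) \<in> fst c} (\<lambda>x. snd c (F (h x)))" if "c \<in> A" for c
    by (rule smooth_on_compose[OF assms(1) smooth_into_chart[OF F that] smooth_on_subset[OF h(1)]])
      (use h(2) in auto)
  ultimately show ?thesis by (force simp: smooth_into_def o_def)
qed

lemma smooth_into_chart_inv:
  assumes c: "c \<in> A"
  shows "smooth_into X A (snd c ` fst c) (chart_inv c)"
proof -
  have "smooth_on {x \<in> snd c ` fst c. chart_inv c x \<in> fst d} (snd d \<circ> chart_inv c)" if "d \<in> A" for d
    by (rule smooth_on_subset[OF transition_smooth[OF c that]]) (auto simp: chart_inv_left[OF c])
  then show ?thesis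
    using continuous_map_chart_inv[OF c] by (auto simp: smooth_into_def)
qed

lemma smooth_into_cong:
  assumes "smooth_into X A S F" and "\<And>x. x \<in> S \<Longrightarrow> F x = G x"
  shows "smooth_into X A S G"
proof -
  have "continuous_map (top_of_set S) X G"
    by (rule continuous_map_eq[of _ _ F]) (use assms in \<open>auto simp: smooth_into_def\<close>)
  moreover have "smooth_on {x \<in> S. G x \<in> fst c} (\<lambda>x. snd c (G x))" if "c \<in> A" for c
  proof -
    have "{x \<in> S. G x \<in> fst c} = {x \<in> S. F x \<in> fst c}" using assms(2) by auto
    then show ?thesis
      using smooth_into_chart[OF assms(1) that] assms(2) smooth_on_cong[of "{x \<in> S. F x \<in> fst c}" "\<lambda>x. snd c (F x)" "\<lambda>x. snd c (G x)"]
      by simp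
  qed
  ultimately show ?thesis by (force simp: smooth_into_def o_def)
qed

text \<open>
  Smoothness is tested on the preimages of chart domains, so uniqueness of derivatives is needed on
  all relatively open subsets of the union.
\<close>

lemma smooth_into_Un_open:
  fixes F :: "'p::euclidean_space \<Rightarrow> 'm"
  assumes acc: "\<And>R. openin (top_of_set (S \<union> T)) R \<Longrightarrow> axis_accessible R"
    and S: "openin (top_of_set (S \<union> T)) S" and T: "openin (top_of_set (S \<union> T)) T"
    and FS: "smooth_into X A S F" and FT: "smooth_into X A T F"
  shows "smooth_into X A (S \<union> T) F"
proof -
  have cont: "continuous_map (top_of_set (S \<union> T)) X F"
    by (rule pasting_lemma[of "{S, T}" _ id _ "\<lambda>_. F"])
      (use S T FS FT in \<open>auto simp: smooth_into_def subtopology_subtopology Int_absorb1 Int_commute\<close>)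
  moreover have "smooth_on {x \<in> S \<union> T. F x \<in> fst c} (\<lambda>x. snd c (F x))" if c: "c \<in> A" for c
    unfolding smooth_on_def
  proof
    fix k
    let ?S = "{x \<in> S. F x \<in> fst c}" and ?T = "{x \<in> T. F x \<in> fst c}"
    have eq: "{x \<in> S \<union> T. F x \<in> fst c} = ?S \<union> ?T" by auto
    have op: "openin (top_of_set (S \<union> T)) {x \<in> S \<union> T. F x \<in> fst c}"
      using openin_continuous_map_preimage[OF cont chart_openin[OF c]] by simp
    have S': "openin (top_of_set (S \<union> T)) ?S" "openin (top_of_set (S \<union> T)) ?T"
      using openin_Int[OF op S] openin_Int[OF op T] by (simp_all add: Int_def conj_ac cong: conj_cong)
    show "Ck_on k {x \<in> S \<union> T. F x \<in> fst c} (\<lambda>x. snd c (F x))"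
      unfolding eq
    proof (rule Ck_on_Un_open)
      show "axis_accessible (?S \<union> ?T)" using acc[OF op] eq by simp
      show "openin (top_of_set (?S \<union> ?T)) ?S" "openin (top_of_set (?S \<union> ?T)) ?T"
        using S' by (auto intro!: openin_subset_trans[of "S \<union> T"])
      show "Ck_on k ?S (\<lambda>x. snd c (F x))" "Ck_on k ?T (\<lambda>x. snd c (F x))"
        using smooth_into_chart[OF FS c] smooth_into_chart[OF FT c] by (auto simp: smooth_on_def)
    qed
  qed
  ultimately show ?thesis by (force simp: smooth_into_def o_def)
qed

lemma smooth_along_vector_field:
  assumes Y: "vector_field X A Y" and F: "smooth_into X A S F"
  shows "smooth_along A S F (\<lambda>x. Y (F x))"
  unfolding smooth_along_def
proof (intro conjI ballI)
  fix x assume "x \<in> S"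
  then show "Y (F x) \<in> tangent_space A (F x)"
    using Y smooth_into_topspace[OF F] by (simp add: vector_field_def)
next
  fix c assume c: "c \<in> A"
  have "smooth_on (snd c ` fst c) (\<lambda>x. Y (chart_inv c x) c)"
    using Y c by (simp add: vector_field_def)
  from smooth_on_compose[OF E this smooth_into_chart[OF F c]]
  have "smooth_on {x \<in> S. F x \<in> fst c} (\<lambda>x. Y (chart_inv c (snd c (F x))) c)" by auto
  then show "smooth_on {x \<in> S. F x \<in> fst c} (\<lambda>x. Y (F x) c)"
    by (rule iffD1[OF smooth_on_cong, rotated]) (simp add: chart_inv_left c)
qed

lemma smooth_fun_compose_chart:
  assumes f: "smooth_fun A f" and F: "smooth_into X A S F" and c: "c \<in> A"
  shows "smooth_on {x \<in> S. F x \<in> fst c} (\<lambda>x. f (F x))"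
proof -
  have "smooth_on (snd c ` fst c) (f \<circ> chart_inv c)" using f c by (simp add: smooth_fun_def)
  from smooth_on_compose[OF E this smooth_into_chart[OF F c]]
  have "smooth_on {x \<in> S. F x \<in> fst c} (\<lambda>x. (f \<circ> chart_inv c) (snd c (F x)))" by auto
  then show ?thesis
    by (rule iffD1[OF smooth_on_cong, rotated]) (simp add: chart_inv_left c)
qed

section \<open>Velocities of curves of paths\<close>

context
  fixes \<epsilon> :: real and \<Gamma> :: "real \<Rightarrow> real \<Rightarrow> 'm"
  assumes plot: "path_plot X A {-\<epsilon><..<\<epsilon>} \<Gamma>" and \<epsilon>: "0 < \<epsilon>"
begin

lemma plot_smooth_into: "smooth_into X A ({-\<epsilon><..<\<epsilon>} \<times> {0..1}) (\<lambda>(s, t). \<Gamma> s t)"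
  using plot by (simp add: path_plot_def)

lemma plot_preimage_openin:
  "c \<in> A \<Longrightarrow> openin (top_of_set ({-\<epsilon><..<\<epsilon>} \<times> {0..1}))
     {(s, t). s \<in> {-\<epsilon><..<\<epsilon>} \<and> t \<in> {0..1} \<and> \<Gamma> s t \<in> fst c}"
  using smooth_into_preimage_openin[OF plot_smooth_into, of c]
  by (rule back_subst[of "openin _"]) auto

lemma plot_chart_C1:
  assumes "c \<in> A"
  shows "Ck_on (Suc 0) {(s, t). s \<in> {-\<epsilon><..<\<epsilon>} \<and> t \<in> {0..1} \<and> \<Gamma> s t \<in> fst c} (\<lambda>(s, t). snd c (\<Gamma> s t))"
proof -
  have "Ck_on (Suc 0) {x \<in> {-\<epsilon><..<\<epsilon>} \<times> {0..1}. (\<lambda>(s, t). \<Gamma> s t) x \<in> fst c} (\<lambda>x. snd c ((\<lambda>(s, t). \<Gamma> s t) x))"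
    using smooth_into_chart[OF plot_smooth_into assms] unfolding smooth_on_def by blast
  moreover have "{x \<in> {-\<epsilon><..<\<epsilon>} \<times> {0..1}. (\<lambda>(s, t). \<Gamma> s t) x \<in> fst c} =
      {(s, t). s \<in> {-\<epsilon><..<\<epsilon>} \<and> t \<in> {0..1} \<and> \<Gamma> s t \<in> fst c}" by auto
  ultimately show ?thesis by (simp add: case_prod_unfold)
qed

lemma plot_chart_derivative:
  assumes c: "c \<in> A" "\<Gamma> 0 t \<in> fst c" and t: "t \<in> {0..1}"
  shows "((\<lambda>s. snd c (\<Gamma> s t)) has_vector_derivative path_velocity A \<Gamma> t c) (at 0)"
  using Ck_on_partial_derivative(1)[OF plot_chart_C1[OF c(1)] _ plot_preimage_openin[OF c(1)], of 0 t] c t \<epsilon>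
  by (simp add: path_velocity_def)

lemma path_velocity_continuous_on:
  assumes c: "c \<in> A"
  shows "continuous_on {t \<in> {0..1}. \<Gamma> 0 t \<in> fst c} (\<lambda>t. path_velocity A \<Gamma> t c)"
proof -
  let ?W = "{(s, t). s \<in> {-\<epsilon><..<\<epsilon>} \<and> t \<in> {0..1} \<and> \<Gamma> s t \<in> fst c}"
  have "continuous_on ?W (\<lambda>(s, t). vector_derivative (\<lambda>s. (\<lambda>(s, t). snd c (\<Gamma> s t)) (s, t)) (at s))"
    by (rule Ck_on_partial_derivative(2)[OF plot_chart_C1[OF c] _ plot_preimage_openin[OF c]]) simp
  then have "continuous_on {t \<in> {0..1}. \<Gamma> 0 t \<in> fst c}
      (\<lambda>t. (\<lambda>(s, t). vector_derivative (\<lambda>s. (\<lambda>(s, t). snd c (\<Gamma> s t)) (s, t)) (at s)) (0, t))"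
    by (rule continuous_on_compose2) (use \<epsilon> in \<open>auto intro!: continuous_intros\<close>)
  then show ?thesis
    by (rule continuous_on_eq) (simp add: path_velocity_def c)
qed

text \<open>
  Used with another chart for \<open>F\<close> it shows that velocities transform as tangent vectors, and with a
  function on the manifold it computes the derivative along the curve.
\<close>

lemma plot_chain_rule:
  fixes F :: "'m \<Rightarrow> 'b::real_normed_vector"
  assumes c: "c \<in> A" "\<Gamma> 0 t \<in> fst c" and t: "t \<in> {0..1}"
    and F: "((F \<circ> chart_inv c) has_derivative G) (at (snd c (\<Gamma> 0 t)))"
  shows "((\<lambda>s. F (\<Gamma> s t)) has_vector_derivative G (path_velocity A \<Gamma> t c)) (at 0)"
proof -
  obtain W' where W': "open W'" "{(s, t). s \<in> {-\<epsilon><..<\<epsilon>} \<and> t \<in> {0..1} \<and> \<Gamma> s t \<in> fst c} =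
      ({-\<epsilon><..<\<epsilon>} \<times> {0..1}) \<inter> W'"
    using plot_preimage_openin[OF c(1)] unfolding openin_open by blast
  \<comment> \<open>The parameters for which the curve through \<open>\<Gamma> 0 t\<close> is in the chart.\<close>
  define Q where "Q = {-\<epsilon><..<\<epsilon>} \<inter> (\<lambda>s. (s, t)) -` W'"
  have Q: "open Q" unfolding Q_def
    by (intro open_Int open_greaterThanLessThan open_vimage W' continuous_intros)
  have mem: "s \<in> Q \<longleftrightarrow> s \<in> {-\<epsilon><..<\<epsilon>} \<and> \<Gamma> s t \<in> fst c" for s
    using W'(2) t by (auto simp: Q_def set_eq_iff)
  have lin: "linear G" using F has_derivative_linear by blast
  have "((\<lambda>s. (F \<circ> chart_inv c) (snd c (\<Gamma> s t))) has_derivative (\<lambda>r. G (r *\<^sub>R path_velocity A \<Gamma> t c))) (at 0)"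
    using has_derivative_compose[OF plot_chart_derivative[OF c t, unfolded has_vector_derivative_def] F] .
  then have "((\<lambda>s. F (\<Gamma> s t)) has_derivative (\<lambda>r. G (r *\<^sub>R path_velocity A \<Gamma> t c))) (at 0)"
    by (rule has_derivative_transform_within_open[OF _ Q])
      (use mem \<epsilon> c chart_inv_left[OF c(1)] in auto)
  then show ?thesis by (simp add: has_vector_derivative_def linear_scale[OF lin])
qed

lemma path_velocity_tangent:
  assumes t: "t \<in> {0..1}"
  shows "path_velocity A \<Gamma> t \<in> tangent_space A (\<Gamma> 0 t)"
  unfolding tangent_space_def
proof (intro CollectI conjI ballI allI impI)
  fix c d assume cd: "c \<in> A" "d \<in> A" "\<Gamma> 0 t \<in> fst c \<and> \<Gamma> 0 t \<in> fst d"
  then have cd': "\<Gamma> 0 t \<in> fst c" "\<Gamma> 0 t \<in> fst d" by auto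
  from vector_derivative_unique_at[OF plot_chart_derivative[OF cd(2) cd'(2) t]
      plot_chain_rule[OF cd(1) cd'(1) t transition_has_derivative[OF cd(1,2) cd']]]
  show "path_velocity A \<Gamma> t d = transition_deriv c d (\<Gamma> 0 t) (path_velocity A \<Gamma> t c)" .
next
  fix c assume "\<not> (c \<in> A \<and> \<Gamma> 0 t \<in> fst c)"
  then show "path_velocity A \<Gamma> t c = 0" using t by (auto simp: path_velocity_def)
qed

text \<open>
  The Leibniz rule requires a partial derivative that is jointly continuous in \<open>s\<close> and \<open>t\<close>. This is a
  local condition, and the preimages of the chart domains, on which the integrand is \<open>C\<^sup>1\<close>, cover
  the domain of the plot.
\<close>

lemma path_average_derivative:
  assumes f: "smooth_fun A f"
  shows "((\<lambda>s. path_average f (\<Gamma> s)) has_real_derivative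
      integral {0..1} (\<lambda>t. differential A f (\<Gamma> 0 t) (path_velocity A \<Gamma> t))) (at 0)"
proof -
  let ?I = "{-\<epsilon><..<\<epsilon>}"
  let ?W = "\<lambda>c. {(s, t). s \<in> ?I \<and> t \<in> {0..1} \<and> \<Gamma> s t \<in> fst c}"
  define h where "h = (\<lambda>(s, t). f (\<Gamma> s t))"
  define hs where "hs = (\<lambda>(s, t). vector_derivative (\<lambda>s. h (s, t)) (at s))"
  have C1: "Ck_on (Suc 0) (?W c) h" if c: "c \<in> A" for c
  proof -
    have "Ck_on (Suc 0) {x \<in> ?I \<times> {0..1}. (\<lambda>(s, t). \<Gamma> s t) x \<in> fst c} (\<lambda>x. f ((\<lambda>(s, t). \<Gamma> s t) x))"
      using smooth_fun_compose_chart[OF f plot_smooth_into c] unfolding smooth_on_def by blast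
    moreover have "{x \<in> ?I \<times> {0..1}. (\<lambda>(s, t). \<Gamma> s t) x \<in> fst c} = ?W c" by auto
    ultimately show ?thesis by (simp add: case_prod_unfold h_def)
  qed
  have cover: "\<exists>c\<in>A. x \<in> ?W c" if x: "x \<in> ?I \<times> {0..1}" for x
  proof -
    obtain s t where st: "x = (s, t)" "s \<in> ?I" "t \<in> {0..1}" using x by blast
    have "\<Gamma> s t \<in> topspace X" using smooth_into_topspace[OF plot_smooth_into x] st by simp
    then obtain c where "c \<in> A" "\<Gamma> s t \<in> fst c" by (rule chart_at)
    then show ?thesis using st by auto
  qed
  have der: "((\<lambda>s. h (s, t)) has_vector_derivative hs (s, t)) (at s)" if st: "s \<in> ?I" "t \<in> {0..1}" for s t
  proof -
    obtain c where c: "c \<in> A" "(s, t) \<in> ?W c" using cover[of "(s, t)"] st by blast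
    show ?thesis
      using Ck_on_partial_derivative(1)[OF C1[OF c(1)] _ plot_preimage_openin[OF c(1)] c(2)]
      by (simp add: hs_def)
  qed
  have conths: "continuous_on (?I \<times> {0..1}) hs"
  proof (rule continuous_on_locally)
    fix x assume x: "x \<in> ?I \<times> {0..1::real}"
    obtain c where c: "c \<in> A" "x \<in> ?W c" using cover[OF x] by blast
    have "continuous_on (?W c) hs"
      using Ck_on_partial_derivative(2)[OF C1[OF c(1)] _ plot_preimage_openin[OF c(1)]]
      by (simp add: hs_def)
    then show "\<exists>J. openin (top_of_set (?I \<times> {0..1})) J \<and> x \<in> J \<and> continuous_on J hs"
      using plot_preimage_openin[OF c(1)] c(2) by blast
  qed
  have conth: "continuous_on (?I \<times> {0..1}) h"
  proof (rule continuous_on_locally)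
    fix x assume x: "x \<in> ?I \<times> {0..1::real}"
    obtain c where c: "c \<in> A" "x \<in> ?W c" using cover[OF x] by blast
    show "\<exists>J. openin (top_of_set (?I \<times> {0..1})) J \<and> x \<in> J \<and> continuous_on J h"
      using plot_preimage_openin[OF c(1)] c(2) Ck_on_imp_continuous_on[OF C1[OF c(1)]] by blast
  qed
  have "((\<lambda>s. integral (cbox 0 1) (\<lambda>t. h (s, t))) has_field_derivative
      integral (cbox 0 1) (\<lambda>t. hs (0, t))) (at 0 within ?I)"
  proof (rule leibniz_rule_field_derivative)
    show "((\<lambda>s. h (s, t)) has_field_derivative hs (s, t)) (at s within ?I)"
      if "s \<in> ?I" "t \<in> cbox 0 1" for s t
      using der[of s t] that
      by (simp add: has_real_derivative_iff_has_vector_derivative has_vector_derivative_at_within)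
    show "(\<lambda>t. h (s, t)) integrable_on cbox 0 1" if "s \<in> ?I" for s
      by (rule integrable_continuous, rule continuous_on_compose2[OF conth])
        (use that in \<open>auto intro!: continuous_intros\<close>)
    show "continuous_on (?I \<times> cbox 0 1) (\<lambda>(s, t). hs (s, t))" using conths by simp
    show "0 \<in> ?I" "convex ?I" using \<epsilon> by auto
  qed
  moreover have "at 0 within ?I = at 0" using \<epsilon> by (intro at_within_open) auto
  moreover have "integral (cbox 0 1) (\<lambda>t. hs (0, t)) =
      integral {0..1} (\<lambda>t. differential A f (\<Gamma> 0 t) (path_velocity A \<Gamma> t))"
    unfolding cbox_interval
  proof (rule integral_cong)
    fix t :: real assume t: "t \<in> {0..1}"
    obtain c where c: "c \<in> A" "\<Gamma> 0 t \<in> fst c" using cover[of "(0, t)"] t \<epsilon> by auto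
    have "((\<lambda>s. h (s, t)) has_vector_derivative
        frechet_derivative (f \<circ> chart_inv c) (at (snd c (\<Gamma> 0 t))) (path_velocity A \<Gamma> t c)) (at 0)"
      using plot_chain_rule[OF c t smooth_fun_has_derivative[OF f c]] by (simp add: h_def)
    from vector_derivative_unique_at[OF der[of 0 t] this]
    show "hs (0, t) = differential A f (\<Gamma> 0 t) (path_velocity A \<Gamma> t)"
      using differential_chart[OF f c path_velocity_tangent[OF t]] t \<epsilon> by simp
  qed
  ultimately show ?thesis by (simp add: path_average_def[abs_def] h_def)
qed

end

end

section \<open>Lifting vector fields to the path space\<close>

definition path_lift ::
  "'m topology \<Rightarrow> ('m, 'e::real_inner) chart set \<Rightarrow> ('m \<Rightarrow> ('m, 'e) tangent) \<Rightarrow>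
     (real \<Rightarrow> 'm) \<Rightarrow> real \<Rightarrow> ('m, 'e) tangent" where
  "path_lift X A Y = (\<lambda>\<gamma>\<in>path_space X A. \<lambda>t\<in>{0..1}. Y (\<gamma> t))"

context framed_manifold
begin

lemma smooth_along_cong:
  assumes "smooth_along A S F V" and "\<And>x. x \<in> S \<Longrightarrow> V x = W x"
  shows "smooth_along A S F W"
proof -
  have "smooth_on {x \<in> S. F x \<in> fst c} (\<lambda>x. W x c)" if "c \<in> A" for c
  proof -
    have "smooth_on {x \<in> S. F x \<in> fst c} (\<lambda>x. V x c)"
      using assms(1) that by (simp add: smooth_along_def)
    then show ?thesis by (rule iffD1[OF smooth_on_cong, rotated]) (simp add: assms(2))
  qed
  then show ?thesis using assms by (simp add: smooth_along_def)
qed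

text \<open>
  In a chart, the lift along a plot is the coordinate expression of \<open>Y\<close> composed with the plot, and
  composition preserves smoothness on any domain.
\<close>

lemma path_vector_field_lift:
  assumes Y: "vector_field X A Y"
  shows "path_vector_field X A (path_lift X A Y)"
  unfolding path_vector_field_def
proof (intro conjI ballI allI impI; (elim conjE)?)
  show "path_lift X A Y \<in> extensional (path_space X A)" by (simp add: path_lift_def)
next
  fix \<gamma> assume \<gamma>: "\<gamma> \<in> path_space X A"
  then have "smooth_into X A {0..1} \<gamma>" by (simp add: path_space_def)
  from smooth_along_vector_field[OF Y this]
  have "smooth_along A {0..1} \<gamma> (path_lift X A Y \<gamma>)"
    by (rule smooth_along_cong) (simp add: path_lift_def \<gamma>)
  then show "path_lift X A Y \<gamma> \<in> path_tangent A \<gamma>"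
    using \<gamma> by (simp add: path_tangent_def path_lift_def)
next
  fix C :: "(nat \<Rightarrow>\<^sub>C real) set" and \<Gamma> assume \<Gamma>: "path_plot X A C \<Gamma>"
  then have "smooth_into X A (C \<times> {0..1}) (\<lambda>(u, t). \<Gamma> u t)" by (simp add: path_plot_def)
  from smooth_along_vector_field[OF Y this]
  show "smooth_along A (C \<times> {0..1}) (\<lambda>(u, t). \<Gamma> u t) (\<lambda>(u, t). path_lift X A Y (\<Gamma> u) t)"
    by (rule smooth_along_cong) (use \<Gamma> in \<open>auto simp: path_lift_def path_plot_def\<close>)
qed

section \<open>Variations supported near one time\<close>

text \<open>
  In the chart \<open>c\<close> the variation is \<open>\<gamma> t + s \<rho>(t) a\<close> with a bump function \<open>\<rho>\<close> supported in the given
  interval. By compactness of the part of \<open>\<gamma>\<close> over that interval, it stays in the chart for small \<open>s\<close>.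
  Where \<open>\<rho>\<close> vanishes the path does not move, so the variation extends by \<open>\<gamma>\<close> to all times, and it is
  smooth because it is smooth on two relatively open pieces: the times at which \<open>\<gamma>\<close> lies in the chart,
  and the times outside the interval. The formula for the velocity holds at every time, since
  \<open>\<rho> t = 0\<close> where \<open>\<gamma> t\<close> is not in the chart.
\<close>

lemma path_variation_exists:
  assumes \<gamma>: "\<gamma> \<in> path_space X A" and c: "c \<in> A"
    and sub: "{\<alpha>..\<beta>} \<inter> {0..1} \<subseteq> {t. \<gamma> t \<in> fst c}"
  obtains \<epsilon> \<Gamma> \<rho> where "0 < \<epsilon>" "path_plot X A {-\<epsilon><..<\<epsilon>} \<Gamma>" "\<Gamma> 0 = \<gamma>"
    "\<And>t. 0 \<le> \<rho> t" "\<And>t. \<rho> t \<noteq> 0 \<longleftrightarrow> \<alpha> < t \<and> t < \<beta>"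
    "\<And>t. t \<in> {0..1} \<Longrightarrow>
       path_velocity A \<Gamma> t = (\<lambda>d. \<rho> t *\<^sub>R tangent_of_coord A c (\<gamma> t) a d)"
proof -
  have g: "smooth_into X A {0..1} \<gamma>" "\<gamma> \<in> extensional {0..1}"
    using \<gamma> by (auto simp: path_space_def)
  obtain \<rho> :: "real \<Rightarrow> real" where \<rho>: "\<And>k S. Ck_on k S \<rho>" "\<And>t. 0 \<le> \<rho> t" "\<And>t. \<rho> t \<le> 1"
    "\<And>t. \<rho> t \<noteq> 0 \<longleftrightarrow> \<alpha> < t \<and> t < \<beta>"
    using smooth_bump_exists[of \<alpha> \<beta>] by blast
  let ?K = "(\<lambda>t. snd c (\<gamma> t)) ` ({\<alpha>..\<beta>} \<inter> {0..1})"
  have "continuous_on ({\<alpha>..\<beta>} \<inter> {0..1}) (\<lambda>t. snd c (\<gamma> t))"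
    by (rule continuous_on_subset[OF smooth_on_imp_continuous_on[OF smooth_into_chart[OF g(1) c]]])
      (use sub in auto)
  then have "compact ?K" by (rule compact_continuous_image) (simp add: compact_Int_closed)
  moreover have "?K \<subseteq> snd c ` fst c" using sub by auto
  ultimately obtain \<delta> where \<delta>: "0 < \<delta>" "(\<Union>x\<in>?K. ball x \<delta>) \<subseteq> snd c ` fst c"
    using compact_subset_open_imp_ball_epsilon_subset[OF _ chart_open_image[OF c]] by metis
  \<comment> \<open>The summand 1 keeps the denominator positive when \<open>a = 0\<close>.\<close>
  define \<epsilon> where "\<epsilon> = \<delta> / (norm a + 1)"
  have \<epsilon>: "0 < \<epsilon>" using \<delta>(1) by (simp add: \<epsilon>_def add_nonneg_pos)
  define G where "G = (\<lambda>(s, t). snd c (\<gamma> t) + (s * \<rho> t) *\<^sub>R a)"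
  have G_mem: "G (s, t) \<in> snd c ` fst c"
    if s: "s \<in> {-\<epsilon><..<\<epsilon>}" and t: "t \<in> {0..1}" "\<gamma> t \<in> fst c" for s t
  proof (cases "\<rho> t = 0")
    case True
    then show ?thesis using t by (simp add: G_def)
  next
    case False
    then have "t \<in> {\<alpha>..\<beta>} \<inter> {0..1}" using \<rho>(4) t by auto
    then have K: "snd c (\<gamma> t) \<in> ?K" by blast
    have "\<bar>s * \<rho> t\<bar> \<le> \<bar>s\<bar> * 1"
      unfolding abs_mult using \<rho>(2,3)[of t] by (intro mult_left_mono) auto
    then have "norm ((s * \<rho> t) *\<^sub>R a) \<le> \<bar>s\<bar> * norm a"
      by (simp add: mult_right_mono)
    also have "\<dots> \<le> \<bar>s\<bar> * (norm a + 1)" by (intro mult_left_mono) auto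
    also have "\<dots> < \<epsilon> * (norm a + 1)"
      using s by (intro mult_strict_right_mono) (auto simp: add_nonneg_pos)
    also have "\<dots> = \<delta>" by (simp add: \<epsilon>_def add_nonneg_eq_0_iff)
    finally have "G (s, t) \<in> ball (snd c (\<gamma> t)) \<delta>" by (simp add: G_def dist_norm)
    then show ?thesis using \<delta>(2) K by blast
  qed
  define \<Gamma> where "\<Gamma> s t = (if t \<in> {0..1} \<and> \<gamma> t \<in> fst c then chart_inv c (G (s, t)) else \<gamma> t)" for s t
  have \<Gamma>_chart: "\<Gamma> s t = chart_inv c (G (s, t))" if "t \<in> {0..1}" "\<gamma> t \<in> fst c" for s t
    using that by (simp add: \<Gamma>_def)
  have \<Gamma>_id: "\<Gamma> s t = \<gamma> t" if "s * \<rho> t = 0" for s t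
  proof (cases "t \<in> {0..1} \<and> \<gamma> t \<in> fst c")
    case True
    have "G (s, t) = snd c (\<gamma> t)" unfolding G_def prod.case that by simp
    then show ?thesis using True chart_inv_left[OF c] by (simp add: \<Gamma>_def)
  qed (auto simp: \<Gamma>_def)
  let ?S = "{-\<epsilon><..<\<epsilon>} \<times> {0..1::real}"
  let ?W1 = "{x \<in> ?S. \<gamma> (snd x) \<in> fst c}" and ?W2 = "{x \<in> ?S. snd x \<notin> {\<alpha>..\<beta>}}"
  have snd_smooth: "smooth_on W snd" for W :: "(real \<times> real) set"
    unfolding smooth_on_def using Ck_on_bounded_linear[OF bounded_linear_snd] by blast
  have union: "?W1 \<union> ?W2 = ?S" using sub by auto
  have op1: "openin (top_of_set ?S) ?W1"
    by (rule smooth_into_preimage_openin[OF smooth_into_compose[OF finite_frame_Basis g(1) snd_smooth] c]) auto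
  have op2: "openin (top_of_set ?S) ?W2"
  proof -
    have "openin (top_of_set ?S) (?S \<inter> snd -` (- {\<alpha>..\<beta>}))"
      by (intro continuous_openin_preimage_gen continuous_intros)
    then show ?thesis by (rule back_subst[of "openin _"]) auto
  qed
  have "smooth_into X A ?W1 (\<lambda>x. chart_inv c (G x))"
  proof (rule smooth_into_compose[OF E smooth_into_chart_inv[OF c]])
    show "smooth_on ?W1 G"
      unfolding smooth_on_def
    proof
      fix k
      have "Ck_on k ?W1 (\<lambda>x. snd c (\<gamma> (snd x)) + (fst x *\<^sub>R \<rho> (snd x)) *\<^sub>R a)"
      proof (intro Ck_on_add Ck_on_scaleR Ck_on_const)
        have "Ck_on k {t \<in> {0..1}. \<gamma> t \<in> fst c} (\<lambda>t. snd c (\<gamma> t))"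
          using smooth_into_chart[OF g(1) c] by (simp add: smooth_on_def)
        then show "Ck_on k ?W1 (\<lambda>x. snd c (\<gamma> (snd x)))"
          by (rule Ck_on_compose[OF finite_frame_Basis _ Ck_on_bounded_linear[OF bounded_linear_snd]]) auto
        show "Ck_on k ?W1 fst" by (rule Ck_on_bounded_linear[OF bounded_linear_fst])
        show "Ck_on k ?W1 (\<lambda>x. \<rho> (snd x))"
          by (rule Ck_on_compose[OF finite_frame_Basis \<rho>(1)[of k UNIV] Ck_on_bounded_linear[OF bounded_linear_snd]]) auto
      qed
      then show "Ck_on k ?W1 G" by (simp add: G_def case_prod_unfold)
    qed
    show "G ` ?W1 \<subseteq> snd c ` fst c" using G_mem by auto
  qed
  then have sm1: "smooth_into X A ?W1 (\<lambda>(s, t). \<Gamma> s t)"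
    by (rule smooth_into_cong) (auto simp: \<Gamma>_chart)
  have "smooth_into X A ?W2 (\<lambda>x. \<gamma> (snd x))"
    by (rule smooth_into_compose[OF finite_frame_Basis g(1) snd_smooth]) auto
  then have sm2: "smooth_into X A ?W2 (\<lambda>(s, t). \<Gamma> s t)"
  proof (rule smooth_into_cong)
    fix x :: "real \<times> real" assume "x \<in> ?W2"
    then have "\<rho> (snd x) = 0" using \<rho>(4)[of "snd x"] by auto
    then show "\<gamma> (snd x) = (\<lambda>(s, t). \<Gamma> s t) x" using \<Gamma>_id[of "fst x" "snd x"] by (simp add: case_prod_unfold)
  qed
  have "smooth_into X A (?W1 \<union> ?W2) (\<lambda>(s, t). \<Gamma> s t)"
  proof (rule smooth_into_Un_open[OF _ _ _ sm1 sm2])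
    show "axis_accessible R" if "openin (top_of_set (?W1 \<union> ?W2)) R" for R
      using axis_accessible_strip[of \<epsilon> R] that unfolding union .
    show "openin (top_of_set (?W1 \<union> ?W2)) ?W1" "openin (top_of_set (?W1 \<union> ?W2)) ?W2"
      unfolding union by (fact op1, fact op2)
  qed
  then have sm: "smooth_into X A ?S (\<lambda>(s, t). \<Gamma> s t)" unfolding union .
  have plot: "path_plot X A {-\<epsilon><..<\<epsilon>} \<Gamma>"
    unfolding path_plot_def
  proof (intro conjI ballI sm)
    fix u assume u: "u \<in> {-\<epsilon><..<\<epsilon>}"
    have "smooth_on {0..1} (\<lambda>t::real. (u, t))"
      unfolding smooth_on_def
    proof
      fix k
      have "Ck_on k {0..1} (\<lambda>t::real. (u, 0) + (0, t))"
        by (intro Ck_on_add Ck_on_const Ck_on_bounded_linear bounded_linear_Pair bounded_linear_zero bounded_linear_ident)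
      then show "Ck_on k {0..1} (\<lambda>t::real. (u, t))" by simp
    qed
    moreover have "(\<lambda>t. (u, t)) ` {0..1} \<subseteq> ?S" using u by auto
    ultimately have "smooth_into X A {0..1} (\<lambda>t. (\<lambda>(s, t). \<Gamma> s t) (u, t))"
      by (rule smooth_into_compose[OF finite_frame_Basis sm])
    then have "smooth_into X A {0..1} (\<Gamma> u)" by simp
    moreover have "\<Gamma> u \<in> extensional {0..1}"
      using g(2) by (auto simp: extensional_def \<Gamma>_def)
    ultimately show "\<Gamma> u \<in> path_space X A" by (simp add: path_space_def)
  qed
  have \<Gamma>0: "\<Gamma> 0 = \<gamma>" using \<Gamma>_id by auto
  have "path_velocity A \<Gamma> t = (\<lambda>d. \<rho> t *\<^sub>R tangent_of_coord A c (\<gamma> t) a d)" if t: "t \<in> {0..1}" for t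
  proof (cases "\<gamma> t \<in> fst c")
    case True
    have v: "path_velocity A \<Gamma> t \<in> tangent_space A (\<gamma> t)"
      using path_velocity_tangent[OF plot \<epsilon> t] \<Gamma>0 by simp
    have w: "(\<lambda>d. \<rho> t *\<^sub>R tangent_of_coord A c (\<gamma> t) a d) \<in> tangent_space A (\<gamma> t)"
      using tangent_lincomb[OF tangent_of_coord_mem[OF c True] tangent_of_coord_mem[OF c True], of "\<rho> t" a 0 a]
      by simp
    have "((\<lambda>s. snd c (\<gamma> t) + (s * \<rho> t) *\<^sub>R a) has_vector_derivative \<rho> t *\<^sub>R a) (at 0)"
      by (auto intro!: derivative_eq_intros simp: has_vector_derivative_def)
    then have "((\<lambda>s. snd c (\<Gamma> s t)) has_vector_derivative \<rho> t *\<^sub>R a) (at 0)"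
      by (rule has_vector_derivative_transform_within_open[of _ _ _ "{-\<epsilon><..<\<epsilon>}"])
        (use \<epsilon> chart_inv_right[OF G_mem[OF _ t True]] \<Gamma>_chart[OF t True] in \<open>auto simp: G_def\<close>)
    from vector_derivative_unique_at[OF plot_chart_derivative[OF plot \<epsilon> c _ t] this]
    have "path_velocity A \<Gamma> t c = \<rho> t *\<^sub>R a" using \<Gamma>0 True by simp
    then show ?thesis
      by (intro tangent_eqI[OF c True v w]) (simp add: tangent_of_coord_self[OF c True])
  next
    case False
    then have "\<rho> t = 0" using \<rho>(4)[of t] sub t by (auto simp: subset_iff)
    then show ?thesis using \<Gamma>_id[of _ t] t by (auto simp: path_velocity_def)
  qed
  then show thesis using that[OF \<epsilon> plot \<Gamma>0 \<rho>(2) \<rho>(4)] by blast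
qed

end

section \<open>The Hamiltonian field of an averaged function\<close>

context framed_symplectic
begin

text \<open>
  The velocity of a curve of paths is tangent to the manifold at each time, so the Hamiltonian
  equation of \<open>f\<close> can be applied under the integral.
\<close>

lemma has_path_differential_lift:
  assumes f: "smooth_fun A f" and \<gamma>: "\<gamma> \<in> path_space X A"
  shows "has_path_differential X A (path_average f) \<gamma>
    (\<lambda>v. - path_form \<omega> \<gamma> (path_lift X A (hamiltonian_vf X A \<omega> f) \<gamma>) v)"
  unfolding has_path_differential_def
proof (intro allI impI; elim conjE)
  fix \<epsilon> :: real and \<Gamma>
  assume *: "0 < \<epsilon>" "path_plot X A {-\<epsilon><..<\<epsilon>} \<Gamma>" "\<Gamma> 0 = \<gamma>"
  have g: "\<gamma> t \<in> topspace X" if "t \<in> {0..1}" for t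
    using smooth_into_topspace[OF _ that, of \<gamma>] \<gamma> by (simp add: path_space_def)
  have "integral {0..1} (\<lambda>t. differential A f (\<gamma> t) (path_velocity A \<Gamma> t)) =
      integral {0..1} (\<lambda>t. - \<omega> (\<gamma> t) (path_lift X A (hamiltonian_vf X A \<omega> f) \<gamma> t) (path_velocity A \<Gamma> t))"
  proof (rule integral_cong)
    fix t :: real assume t: "t \<in> {0..1}"
    show "differential A f (\<gamma> t) (path_velocity A \<Gamma> t) =
        - \<omega> (\<gamma> t) (path_lift X A (hamiltonian_vf X A \<omega> f) \<gamma> t) (path_velocity A \<Gamma> t)"
      using hamiltonian_vf(2)[OF f g[OF t], of "path_velocity A \<Gamma> t"] path_velocity_tangent[OF *(2,1) t] *(3)
      by (simp add: path_lift_def \<gamma> t[simplified])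
  qed
  then show "((\<lambda>s. path_average f (\<Gamma> s)) has_real_derivative
      - path_form \<omega> \<gamma> (path_lift X A (hamiltonian_vf X A \<omega> f) \<gamma>) (path_velocity A \<Gamma>)) (at 0)"
    using path_average_derivative[OF *(2,1) f] *(3) by (simp add: path_form_def)
qed

lemma form_in_chart_continuous_on:
  "c \<in> A \<Longrightarrow> continuous_on (snd c ` fst c) (\<lambda>x. form_in_chart A \<omega> c x a b)"
  using symplectic smooth_on_imp_continuous_on
  unfolding symplectic_form_def smooth_2form_def by blast

lemma form_continuous_on:
  assumes g: "smooth_into X A S \<gamma>"
    and V: "\<And>t. t \<in> S \<Longrightarrow> V t \<in> tangent_space A (\<gamma> t)"
    and Vc: "\<And>c. c \<in> A \<Longrightarrow> continuous_on {t \<in> S. \<gamma> t \<in> fst c} (\<lambda>t. V t c)"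
    and W: "\<And>t. t \<in> S \<Longrightarrow> W t \<in> tangent_space A (\<gamma> t)"
    and Wc: "\<And>c. c \<in> A \<Longrightarrow> continuous_on {t \<in> S. \<gamma> t \<in> fst c} (\<lambda>t. W t c)"
  shows "continuous_on S (\<lambda>t. \<omega> (\<gamma> t) (V t) (W t))"
proof (rule continuous_on_locally)
  fix x assume x: "x \<in> S"
  obtain c where c: "c \<in> A" "\<gamma> x \<in> fst c" using chart_at smooth_into_topspace[OF g x] by metis
  let ?J = "{t \<in> S. \<gamma> t \<in> fst c}"
  have "continuous_on ?J (\<lambda>t. \<Sum>a\<in>E. \<Sum>b\<in>E. (V t c \<bullet> a) * ((W t c \<bullet> b) * form_in_chart A \<omega> c (snd c (\<gamma> t)) a b))"
    by (intro continuous_intros Vc Wc c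
        continuous_on_compose2[OF form_in_chart_continuous_on[OF c(1)] smooth_on_imp_continuous_on[OF smooth_into_chart[OF g c(1)]]]) auto
  then have "continuous_on ?J (\<lambda>t. \<omega> (\<gamma> t) (V t) (W t))"
  proof (rule continuous_on_eq)
    fix t assume t: "t \<in> ?J"
    then have y: "snd c (\<gamma> t) \<in> snd c ` fst c" by auto
    have "\<omega> (\<gamma> t) (V t) (W t) = form_in_chart A \<omega> c (snd c (\<gamma> t)) (V t c) (W t c)"
      using form_chart[OF c(1)] V W t by auto
    also have "\<dots> = (\<Sum>a\<in>E. (V t c \<bullet> a) *\<^sub>R form_in_chart A \<omega> c (snd c (\<gamma> t)) a (W t c))"
      by (rule linear_frame_expand[OF E linear_form_in_chart(1)[OF c(1) y]])
    also have "\<dots> = (\<Sum>a\<in>E. (V t c \<bullet> a) *\<^sub>R (\<Sum>b\<in>E. (W t c \<bullet> b) *\<^sub>R form_in_chart A \<omega> c (snd c (\<gamma> t)) a b))"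
      using linear_frame_expand[OF E linear_form_in_chart(2)[OF c(1) y], of _ "W t c"]
      by (intro sum.cong refl arg_cong[where f = "scaleR _"])
    finally show "(\<Sum>a\<in>E. \<Sum>b\<in>E. (V t c \<bullet> a) * ((W t c \<bullet> b) * form_in_chart A \<omega> c (snd c (\<gamma> t)) a b)) =
        \<omega> (\<gamma> t) (V t) (W t)"
      by (simp add: sum_distrib_left)
  qed
  then show "\<exists>J. openin (top_of_set S) J \<and> x \<in> J \<and> continuous_on J (\<lambda>t. \<omega> (\<gamma> t) (V t) (W t))"
    using smooth_into_preimage_openin[OF g c(1)] x c(2) by blast
qed

text \<open>
  Weak nondegeneracy of the form on the path space, tested against velocities of curves only: the
  variations of \<open>path_variation_exists\<close> localise the integral near a time at which the two vectors
  differ.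
\<close>

lemma path_tangent_separation:
  assumes \<gamma>: "\<gamma> \<in> path_space X A"
    and V1: "V1 \<in> path_tangent A \<gamma>" and V2: "V2 \<in> path_tangent A \<gamma>"
    and eq: "\<And>\<epsilon> \<Gamma>. 0 < \<epsilon> \<Longrightarrow> path_plot X A {-\<epsilon><..<\<epsilon>} \<Gamma> \<Longrightarrow> \<Gamma> 0 = \<gamma> \<Longrightarrow>
      path_form \<omega> \<gamma> V1 (path_velocity A \<Gamma>) = path_form \<omega> \<gamma> V2 (path_velocity A \<Gamma>)"
  shows "V1 = V2"
proof (rule extensionalityI[of _ "{0..1}"])
  show "V1 \<in> extensional {0..1}" "V2 \<in> extensional {0..1}"
    using V1 V2 by (auto simp: path_tangent_def)
  have g: "smooth_into X A {0..1} \<gamma>" using \<gamma> by (simp add: path_space_def)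
  have V: "V1 t \<in> tangent_space A (\<gamma> t)" "V2 t \<in> tangent_space A (\<gamma> t)" if "t \<in> {0..1}" for t
    using V1 V2 that by (auto simp: path_tangent_def smooth_along_def)
  have Vc: "continuous_on {t \<in> {0..1}. \<gamma> t \<in> fst c} (\<lambda>t. V1 t c)"
    "continuous_on {t \<in> {0..1}. \<gamma> t \<in> fst c} (\<lambda>t. V2 t c)" if "c \<in> A" for c
    by (rule smooth_on_imp_continuous_on, use V1 V2 that in \<open>simp add: path_tangent_def smooth_along_def\<close>)+
  \<comment> \<open>The difference is written as a linear combination so that the bilinearity rules apply to it.\<close>
  define D where "D t = (\<lambda>c. 1 *\<^sub>R V1 t c + (- 1) *\<^sub>R V2 t c)" for t
  have D: "D t \<in> tangent_space A (\<gamma> t)" if "t \<in> {0..1}" for t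
    unfolding D_def by (rule tangent_lincomb[OF V[OF that]])
  have Dc: "continuous_on {t \<in> {0..1}. \<gamma> t \<in> fst c} (\<lambda>t. D t c)" if "c \<in> A" for c
    unfolding D_def by (intro continuous_intros Vc that)
  fix t0 :: real assume t0: "t0 \<in> {0..1}"
  have top: "\<gamma> t \<in> topspace X" if "t \<in> {0..1}" for t using smooth_into_topspace[OF g that] .
  obtain c where c: "c \<in> A" "\<gamma> t0 \<in> fst c" using chart_at[OF top[OF t0]] .
  let ?J = "{t \<in> {0..1}. \<gamma> t \<in> fst c}"
  show "V1 t0 = V2 t0"
  proof (rule ccontr)
    assume "V1 t0 \<noteq> V2 t0"
    then have "D t0 \<noteq> (\<lambda>_. 0)" by (auto simp: D_def fun_eq_iff)
    then obtain w where w: "w \<in> tangent_space A (\<gamma> t0)" "\<omega> (\<gamma> t0) (D t0) w \<noteq> 0"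
      using form_nondegenerate[OF top[OF t0] D[OF t0]] by blast
    \<comment> \<open>The sign makes the value of the form at \<open>D t0\<close> and \<open>a\<close> positive.\<close>
    define a where "a = sgn (\<omega> (\<gamma> t0) (D t0) w) *\<^sub>R w c"
    define k where "k t = form_in_chart A \<omega> c (snd c (\<gamma> t)) (D t c) a" for t
    have k: "k t = \<omega> (\<gamma> t) (D t) (tangent_of_coord A c (\<gamma> t) a)" if "t \<in> ?J" for t
      using that form_chart[OF c(1) _ D tangent_of_coord_mem[OF c(1)]] tangent_of_coord_self[OF c(1)]
      by (auto simp: k_def)
    have "k t0 = sgn (\<omega> (\<gamma> t0) (D t0) w) * \<omega> (\<gamma> t0) (D t0) w"
      using linear_scale[OF linear_form_in_chart(2)[OF c(1)], of "snd c (\<gamma> t0)"] c(2)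
        form_chart[OF c D[OF t0] w(1)]
      by (auto simp: k_def a_def)
    then have k0: "0 < k t0" using w(2) by (simp add: sgn_if)
    have kc: "continuous_on ?J k"
    proof -
      have "continuous_on ?J (\<lambda>t. \<Sum>b\<in>E. (D t c \<bullet> b) * form_in_chart A \<omega> c (snd c (\<gamma> t)) b a)"
        by (intro continuous_intros Dc c(1) continuous_on_compose2[OF form_in_chart_continuous_on[OF c(1)]
              smooth_on_imp_continuous_on[OF smooth_into_chart[OF g c(1)]]]) auto
      then show ?thesis
      proof (rule continuous_on_eq)
        fix t assume "t \<in> ?J"
        then have "snd c (\<gamma> t) \<in> snd c ` fst c" by auto
        from linear_frame_expand[OF E linear_form_in_chart(1)[OF c(1) this], of "D t c" a]
        show "(\<Sum>b\<in>E. (D t c \<bullet> b) * form_in_chart A \<omega> c (snd c (\<gamma> t)) b a) = k t"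
          unfolding k_def by simp
      qed
    qed
    obtain r where r: "0 < r" "\<And>t. t \<in> {0..1} \<Longrightarrow> \<bar>t - t0\<bar> < r \<Longrightarrow> \<gamma> t \<in> fst c \<and> 0 < k t"
    proof -
      have "openin (top_of_set ?J) (?J \<inter> k -` {0<..})"
        by (rule continuous_openin_preimage_gen[OF kc]) simp
      then have "openin (top_of_set {0..1}) (?J \<inter> k -` {0<..})"
        using openin_trans smooth_into_preimage_openin[OF g c(1)] by blast
      moreover have "t0 \<in> ?J \<inter> k -` {0<..}" using t0 c k0 by simp
      ultimately obtain r where r: "0 < r" "\<forall>t\<in>{0..1}. dist t t0 < r \<longrightarrow> t \<in> ?J \<inter> k -` {0<..}"
        by (meson openin_euclidean_subtopology_iff)
      show ?thesis using that[OF r(1)] r(2) by (auto simp: dist_real_def)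
    qed
    have "{t0 - r / 2..t0 + r / 2} \<inter> {0..1} \<subseteq> {t. \<gamma> t \<in> fst c}"
      using r by (auto simp: abs_less_iff)
    from path_variation_exists[OF \<gamma> c(1) this, where a = a]
    obtain \<epsilon> \<Gamma> \<rho> where \<Gamma>: "0 < \<epsilon>" "path_plot X A {-\<epsilon><..<\<epsilon>} \<Gamma>" "\<Gamma> 0 = \<gamma>"
      and \<rho>: "\<And>t. 0 \<le> \<rho> t" "\<And>t. \<rho> t \<noteq> 0 \<longleftrightarrow> t0 - r / 2 < t \<and> t < t0 + r / 2"
      and vel: "\<And>t. t \<in> {0..1} \<Longrightarrow>
        path_velocity A \<Gamma> t = (\<lambda>d. \<rho> t *\<^sub>R tangent_of_coord A c (\<gamma> t) a d)"
      by blast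
    have U: "path_velocity A \<Gamma> t \<in> tangent_space A (\<gamma> t)" if "t \<in> {0..1}" for t
      using path_velocity_tangent[OF \<Gamma>(2,1) that] \<Gamma>(3) by simp
    have Uc: "continuous_on {t \<in> {0..1}. \<gamma> t \<in> fst c} (\<lambda>t. path_velocity A \<Gamma> t c)" if "c \<in> A" for c
      using path_velocity_continuous_on[OF \<Gamma>(2,1) that] \<Gamma>(3) by simp
    define I where "I t = \<omega> (\<gamma> t) (D t) (path_velocity A \<Gamma> t)" for t
    have I: "I t = \<omega> (\<gamma> t) (V1 t) (path_velocity A \<Gamma> t) - \<omega> (\<gamma> t) (V2 t) (path_velocity A \<Gamma> t)"
      if "t \<in> {0..1}" for t
      unfolding I_def D_def form_lincomb_left[OF top[OF that] V[OF that] U[OF that]] by simp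
    have "integral {0..1} I = path_form \<omega> \<gamma> V1 (path_velocity A \<Gamma>) - path_form \<omega> \<gamma> V2 (path_velocity A \<Gamma>)"
      unfolding path_form_def
      by (subst integral_diff[symmetric])
        (auto intro!: integrable_continuous_interval form_continuous_on g V Vc U Uc integral_cong I)
    then have int0: "integral {0..1} I = 0" using eq[OF \<Gamma>] by simp
    have Ik: "I t = \<rho> t * k t" if t: "t \<in> ?J" for t
    proof -
      have m: "tangent_of_coord A c (\<gamma> t) a \<in> tangent_space A (\<gamma> t)"
        using tangent_of_coord_mem[OF c(1)] t by auto
      show ?thesis
        using form_lincomb_right[OF top m m D, of "\<rho> t" 0] t by (simp add: I_def vel k)
    qed
    have "0 \<le> I t" if t: "t \<in> {0..1}" for t
    proof (cases "\<rho> t = 0")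
      case True
      have "I t = 0"
        using form_lincomb_right[OF top[OF t] V(1)[OF t] V(1)[OF t] D[OF t], of 0 0] t True by (simp add: I_def vel)
      then show ?thesis by simp
    next
      case False
      then have "\<bar>t - t0\<bar> < r" using \<rho>(2)[of t] r(1) by (auto simp: abs_less_iff)
      then show ?thesis using Ik[of t] r(2)[OF t] \<rho>(1)[of t] t by simp
    qed
    moreover have "continuous_on {0..1} I"
      unfolding I_def by (intro form_continuous_on g D Dc U Uc)
    ultimately have "I t0 = 0"
      using integral_cbox_eq_0_iff[of 0 "1::real" I] int0 t0 by (simp add: cbox_interval box_real)
    moreover have "\<rho> t0 \<noteq> 0" using \<rho>(2)[of t0] r(1) by simp
    ultimately show False using Ik[of t0] k0 t0 c(2) by simp
  qed
qed

text \<open>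
  Two solutions of the defining equation have the same derivative along every curve through \<open>\<gamma>\<close>, so
  they pair equally with all velocities and agree by the separation lemma.
\<close>

lemma path_hamiltonian_vf_eq_lift:
  assumes f: "smooth_fun A f"
  shows "path_hamiltonian_vf X A \<omega> (path_average f) = path_lift X A (hamiltonian_vf X A \<omega> f)"
proof -
  let ?H = "path_lift X A (hamiltonian_vf X A \<omega> f)"
  let ?D = "\<lambda>\<Xi>. \<forall>\<gamma>\<in>path_space X A.
    has_path_differential X A (path_average f) \<gamma> (\<lambda>v. - path_form \<omega> \<gamma> (\<Xi> \<gamma>) v)"
  have H: "path_vector_field X A ?H" "?D ?H"
    using path_vector_field_lift[OF hamiltonian_vf(1)[OF f]] has_path_differential_lift[OF f] by auto
  have uniq: "\<Xi> = ?H" if \<Xi>: "path_vector_field X A \<Xi>" "?D \<Xi>" for \<Xi>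
  proof (rule extensionalityI[of _ "path_space X A"])
    show "\<Xi> \<in> extensional (path_space X A)" "?H \<in> extensional (path_space X A)"
      using \<Xi>(1) H(1) by (auto simp: path_vector_field_def)
    fix \<gamma> assume \<gamma>: "\<gamma> \<in> path_space X A"
    show "\<Xi> \<gamma> = ?H \<gamma>"
    proof (rule path_tangent_separation[OF \<gamma>])
      show "\<Xi> \<gamma> \<in> path_tangent A \<gamma>" "?H \<gamma> \<in> path_tangent A \<gamma>"
        using \<Xi>(1) H(1) \<gamma> by (auto simp: path_vector_field_def)
      fix \<epsilon> :: real and \<Gamma> assume *: "0 < \<epsilon>" "path_plot X A {-\<epsilon><..<\<epsilon>} \<Gamma>" "\<Gamma> 0 = \<gamma>"
      have "((\<lambda>s. path_average f (\<Gamma> s)) has_real_derivative - path_form \<omega> \<gamma> (\<Xi> \<gamma>) (path_velocity A \<Gamma>)) (at 0)"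
        "((\<lambda>s. path_average f (\<Gamma> s)) has_real_derivative - path_form \<omega> \<gamma> (?H \<gamma>) (path_velocity A \<Gamma>)) (at 0)"
        using \<Xi>(2) H(2) \<gamma> * by (auto simp: has_path_differential_def)
      from DERIV_unique[OF this]
      show "path_form \<omega> \<gamma> (\<Xi> \<gamma>) (path_velocity A \<Gamma>) = path_form \<omega> \<gamma> (?H \<gamma>) (path_velocity A \<Gamma>)" by simp
    qed
  qed
  show ?thesis
    unfolding path_hamiltonian_vf_def by (rule the_equality) (use H uniq in blast)+
qed

end

text \<open>
  After both Hamiltonian fields on the path space are replaced by lifts, the two integrands agree.
\<close>

theorem corollary2p2:
  fixes X :: "'m topology"
    and A :: "('m, 'e::real_inner) chart set"
    and \<omega> :: "('m, 'e) form2"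
    and f g :: "'m \<Rightarrow> real"
  assumes "smooth_manifold X A" and "compact_space X" and "connected_space X"
    and "symplectic_form X A \<omega>"
    and "smooth_fun A f" and "smooth_fun A g"
  shows "\<forall>\<gamma>\<in>path_space X A.
    path_poisson X A \<omega> (path_average f) (path_average g) \<gamma> =
      integral {0..1} (\<lambda>t. poisson X A \<omega> f g (\<gamma> t))"
proof
  fix \<gamma> assume \<gamma>: "\<gamma> \<in> path_space X A"
  obtain B :: "'e set" where "finite B" "span B = UNIV"
    using assms(1) by (auto simp: smooth_manifold_def)
  then obtain E :: "'e set" where "finite_frame E" by (rule finite_frame_exists)
  then interpret framed_symplectic X A E \<omega>
    by unfold_locales (use assms in auto)
  show "path_poisson X A \<omega> (path_average f) (path_average g) \<gamma> =
      integral {0..1} (\<lambda>t. poisson X A \<omega> f g (\<gamma> t))"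
    unfolding path_poisson_def path_form_def poisson_def
      path_hamiltonian_vf_eq_lift[OF assms(5)] path_hamiltonian_vf_eq_lift[OF assms(6)]
    by (rule integral_cong) (simp add: path_lift_def \<gamma>)
qed

end
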